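(* Let $d\ge1$ be an integer, $r>d+1$ real, and $m,n\ge1$ integers. There exist $\boldsymbol t_1,\dots,\boldsymbol t_n\in(T^d)^m$ such that $$e_{n,m}^2(\boldsymbol t_1,\dots,\boldsymbol t_n)\le\frac1n\left(\prod_{j=1}^m\left(1+\gamma_{m,j}c_{d,r}\right)-1\right).$$
   Context: $T^d=\{x\in\mathbb R^d: x_1\ge0,\dots,x_d\ge0,\ 1-(x_1+\cdots+x_d)\ge0\}$. $L_2(T^d)$ carries the inner product $\langle f,g\rangle=d!\int_{T^d}f(x)g(x)\,dx$. For $\ell\in\mathbb N_0$, $\mathcal V_\ell^d$ is the space of real polynomials in $d$ variables of degree at most $\ell$ that are orthogonal to all polynomials of degree less than $\ell$; $r_\ell^d=\dim\mathcal V_\ell^d=\binom{\ell+d-1}{\ell}$; $\{P_{\ell,k}:1\le k\le r_\ell^d\}$ is a fixed orthonormal basis of $\mathcal V_\ell^d$, with $P_{0,1}=1$. Put $P_\ell(x,y)=\sum_{k=1}^{r_\ell^d}P_{\ell,k}(x)P_{\ell,k}(y)$. Let $M$ be a fixed constant depending only on $d$ such that $P_\ell(x,y)\le M\ell^{2d}$ for all $\ell\ge1$ and $x,y\in T^d$ (such a constant exists), and set $c_{d,r}=M\sum_{\ell=1}^\infty\frac{\ell^{2d}}{[\ell(\ell+d)]^r}$. The weights $\gamma_{m,j}$ ($m\ge1$, $1\le j\le m$) are positive and uniformly bounded: $\sup_{m\ge1}\max_{1\le j\le m}\gamma_{m,j}<\infty$. For $\gamma>0$ let $B_{d,r,\gamma}(0)=1$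 and $B_{d,r,\gamma}(\ell)=\frac1\gamma[\ell(\ell+d)]^r$ for $\ell\ge1$. $H_{1,\gamma}^{(d,r)}\subseteq L_2(T^d)$ is the closure of the polynomials under the norm $\|f\|_1^2=\sum_{\ell=0}^\infty\sum_{k=1}^{r_\ell^d}B_{d,r,\gamma}(\ell)\,a_k^\ell(f)^2$, where $a_k^\ell(f)=d!\int_{T^d}fP_{\ell,k}\,dx$; for $r>d+1$ its elements are continuous and it is a reproducing kernel Hilbert space. $H_m$ is the Hilbert space tensor product $H_{1,\gamma_{m,1}}^{(d,r)}\otimes\cdots\otimes H_{1,\gamma_{m,m}}^{(d,r)}$ of functions on $(T^d)^m$, with inner product $$\langle f,g\rangle_m=\sum_{\boldsymbol\ell\in\mathbb N_0^m}\ \sum_{\boldsymbol k:\,1\le k_j\le r_{\ell_j}^d}\Big(\prod_{j=1}^mB_{d,r,\gamma_{m,j}}(\ell_j)\Big)a_{\boldsymbol k}^{\boldsymbol\ell}(f)a_{\boldsymbol k}^{\boldsymbol\ell}(g),\qquad a_{\boldsymbol k}^{\boldsymbol\ell}(f)=(d!)^m\int_{(T^d)^m}f(\boldsymbol x)\prod_{j=1}^mP_{\ell_j,k_j}(x_j)\,d\boldsymbol x,$$ norm $\|\cdot\|_m$, and reproducing kernel $K_m(\boldsymbol x,\boldsymbol y)=\prod_{j=1}^m\Big(1+\gamma_{m,j}\sum_{\ell=1}^\infty\frac{P_\ell(x_j,y_j)}{[\ell(\ell+d)]^r}\Big)$. $I_m(f)=(d!)^m\int_{(T^d)^m}f(\boldsymbol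 x)\,d\boldsymbol x$, and for $\boldsymbol t_1,\dots,\boldsymbol t_n\in(T^d)^m$, $Q_{n,m}(f)=\frac1n\sum_{i=1}^nf(\boldsymbol t_i)$. The worst-case error is $e_{n,m}=e_{n,m}(\boldsymbol t_1,\dots,\boldsymbol t_n)=\sup\{|I_m(f)-Q_{n,m}(f)|:f\in H_m,\ \|f\|_m\le1\}$. *)

theory Defs
  imports "HOL-Analysis.Analysis"
begin

definition simplex_T :: "(real ^ 'd::finite) set" where
  "simplex_T = {x. (\<forall>i. x $ i \<ge> 0) \<and> 1 - (\<Sum>i\<in>UNIV. x $ i) \<ge> 0}"

definition inner_T :: "(real ^ 'd::finite \<Rightarrow> real) \<Rightarrow> (real ^ 'd \<Rightarrow> real) \<Rightarrow> real" where
  "inner_T f g = fact CARD('d) * (LINT x:simplex_T|lborel. f x * g x)"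

text \<open>Real polynomials in \<open>d = CARD('d)\<close> variables of total degree at most \<open>l\<close>, as functions.
  The set of exponents is finite, so the sum is a genuine one.\<close>

definition polys_le :: "nat \<Rightarrow> (real ^ 'd::finite \<Rightarrow> real) set" where
  "polys_le l = {p. \<exists>c :: ('d \<Rightarrow> nat) \<Rightarrow> real.
     p = (\<lambda>x. \<Sum>\<alpha> | (\<Sum>i\<in>UNIV. \<alpha> i) \<le> l. c \<alpha> * (\<Prod>i\<in>UNIV. (x $ i) ^ \<alpha> i))}"

definition V_space :: "nat \<Rightarrow> (real ^ 'd::finite \<Rightarrow> real) set" where
  "V_space l = {p \<in> polys_le l. \<forall>k<l. \<forall>q \<in> polys_le k. inner_T p q = 0}"

definition r_dim :: "nat \<Rightarrow> nat \<Rightarrow> nat" where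
  "r_dim d l = (l + d - 1) choose l"

definition is_ONB_family :: "(nat \<Rightarrow> nat \<Rightarrow> real ^ 'd::finite \<Rightarrow> real) \<Rightarrow> bool" where
  "is_ONB_family P \<longleftrightarrow>
     (\<forall>l. (\<forall>k\<in>{1..r_dim CARD('d) l}. P l k \<in> V_space l) \<and>
          (\<forall>k\<in>{1..r_dim CARD('d) l}. \<forall>k'\<in>{1..r_dim CARD('d) l}.
             inner_T (P l k) (P l k') = (if k = k' then 1 else 0)) \<and>
          (\<forall>f\<in>V_space l. \<exists>c. f = (\<lambda>x. \<Sum>k=1..r_dim CARD('d) l. c k * P l k x)))"

definition P_kernel ::
  "(nat \<Rightarrow> nat \<Rightarrow> real ^ 'd::finite \<Rightarrow> real) \<Rightarrow> nat \<Rightarrow> real ^ 'd \<Rightarrow> real ^ 'd \<Rightarrow> real" where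
  "P_kernel P l x y = (\<Sum>k=1..r_dim CARD('d) l. P l k x * P l k y)"

definition c_const :: "nat \<Rightarrow> real \<Rightarrow> real \<Rightarrow> real" where
  "c_const d r M =
     M * (\<Sum>i. let l = Suc i in real l ^ (2 * d) / (real (l * (l + d)) powr r))"

definition B_coeff :: "nat \<Rightarrow> real \<Rightarrow> real \<Rightarrow> nat \<Rightarrow> real" where
  "B_coeff d r g l = (if l = 0 then 1 else 1 / g * real (l * (l + d)) powr r)"

definition coeff1 ::
  "(nat \<Rightarrow> nat \<Rightarrow> real ^ 'd::finite \<Rightarrow> real) \<Rightarrow> nat \<Rightarrow> nat \<Rightarrow> (real ^ 'd \<Rightarrow> real) \<Rightarrow> real" where
  "coeff1 P l k f = fact CARD('d) * (LINT x:simplex_T|lborel. f x * P l k x)"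

definition norm1_term ::
  "(nat \<Rightarrow> nat \<Rightarrow> real ^ 'd::finite \<Rightarrow> real) \<Rightarrow> real \<Rightarrow> real \<Rightarrow> (real ^ 'd \<Rightarrow> real) \<Rightarrow> nat \<Rightarrow> real" where
  "norm1_term P r g f l =
     (\<Sum>k=1..r_dim CARD('d) l. B_coeff CARD('d) r g l * (coeff1 P l k f)\<^sup>2)"

definition norm1 ::
  "(nat \<Rightarrow> nat \<Rightarrow> real ^ 'd::finite \<Rightarrow> real) \<Rightarrow> real \<Rightarrow> real \<Rightarrow> (real ^ 'd \<Rightarrow> real) \<Rightarrow> real" where
  "norm1 P r g f = sqrt (\<Sum>l. norm1_term P r g f l)"

text \<open>The closure of the polynomials under \<open>norm1\<close>. For \<open>r > d + 1\<close> every class in this closure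
  has a (unique) continuous representative, and it is this representative that is meant.
  Only values on \<open>simplex_T\<close> matter. Since \<open>norm1\<close> takes a junk value on divergent
  series, convergence is demanded separately.\<close>

definition H1_space ::
  "(nat \<Rightarrow> nat \<Rightarrow> real ^ 'd::finite \<Rightarrow> real) \<Rightarrow> real \<Rightarrow> real \<Rightarrow> (real ^ 'd \<Rightarrow> real) set" where
  "H1_space P r g = {f. continuous_on simplex_T f \<and> summable (norm1_term P r g f) \<and>
     (\<forall>\<epsilon>>0. \<exists>l. \<exists>p\<in>polys_le l.
        summable (norm1_term P r g (\<lambda>x. f x - p x)) \<and> norm1 P r g (\<lambda>x. f x - p x) < \<epsilon>)}"

text \<open>Points of \<open>(T\<^sup>d)\<^sup>m\<close> are families indexed by \<open>{1..m}\<close>, as are the multi-indices below.\<close>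

definition cube_T :: "nat \<Rightarrow> (nat \<Rightarrow> real ^ 'd::finite) set" where
  "cube_T m = {1..m} \<rightarrow>\<^sub>E simplex_T"

definition integral_m :: "nat \<Rightarrow> ((nat \<Rightarrow> real ^ 'd::finite) \<Rightarrow> real) \<Rightarrow> real" where
  "integral_m m f = fact CARD('d) ^ m * (LINT x:cube_T m|(\<Pi>\<^sub>M j\<in>{1..m}. lborel). f x)"

definition coeff_m ::
  "(nat \<Rightarrow> nat \<Rightarrow> real ^ 'd::finite \<Rightarrow> real) \<Rightarrow> nat \<Rightarrow> (nat \<Rightarrow> nat) \<Rightarrow> (nat \<Rightarrow> nat)
     \<Rightarrow> ((nat \<Rightarrow> real ^ 'd) \<Rightarrow> real) \<Rightarrow> real" where
  "coeff_m P m l k f = integral_m m (\<lambda>x. f x * (\<Prod>j=1..m. P (l j) (k j) (x j)))"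

definition inner_m_term ::
  "(nat \<Rightarrow> nat \<Rightarrow> real ^ 'd::finite \<Rightarrow> real) \<Rightarrow> real \<Rightarrow> (nat \<Rightarrow> nat \<Rightarrow> real) \<Rightarrow> nat
     \<Rightarrow> ((nat \<Rightarrow> real ^ 'd) \<Rightarrow> real) \<Rightarrow> ((nat \<Rightarrow> real ^ 'd) \<Rightarrow> real) \<Rightarrow> (nat \<Rightarrow> nat) \<Rightarrow> real" where
  "inner_m_term P r \<gamma> m f g l =
     (\<Sum>k\<in>(\<Pi>\<^sub>E j\<in>{1..m}. {1..r_dim CARD('d) (l j)}).
        (\<Prod>j=1..m. B_coeff CARD('d) r (\<gamma> m j) (l j)) * coeff_m P m l k f * coeff_m P m l k g)"

definition inner_m ::
  "(nat \<Rightarrow> nat \<Rightarrow> real ^ 'd::finite \<Rightarrow> real) \<Rightarrow> real \<Rightarrow> (nat \<Rightarrow> nat \<Rightarrow> real) \<Rightarrow> nat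
     \<Rightarrow> ((nat \<Rightarrow> real ^ 'd) \<Rightarrow> real) \<Rightarrow> ((nat \<Rightarrow> real ^ 'd) \<Rightarrow> real) \<Rightarrow> real" where
  "inner_m P r \<gamma> m f g = (\<Sum>\<^sub>\<infinity>l\<in>({1..m} \<rightarrow>\<^sub>E UNIV). inner_m_term P r \<gamma> m f g l)"

definition norm_m ::
  "(nat \<Rightarrow> nat \<Rightarrow> real ^ 'd::finite \<Rightarrow> real) \<Rightarrow> real \<Rightarrow> (nat \<Rightarrow> nat \<Rightarrow> real) \<Rightarrow> nat
     \<Rightarrow> ((nat \<Rightarrow> real ^ 'd) \<Rightarrow> real) \<Rightarrow> real" where
  "norm_m P r \<gamma> m f = sqrt (inner_m P r \<gamma> m f f)"

definition finite_norm_m ::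
  "(nat \<Rightarrow> nat \<Rightarrow> real ^ 'd::finite \<Rightarrow> real) \<Rightarrow> real \<Rightarrow> (nat \<Rightarrow> nat \<Rightarrow> real) \<Rightarrow> nat
     \<Rightarrow> ((nat \<Rightarrow> real ^ 'd) \<Rightarrow> real) \<Rightarrow> bool" where
  "finite_norm_m P r \<gamma> m f \<longleftrightarrow> inner_m_term P r \<gamma> m f f summable_on ({1..m} \<rightarrow>\<^sub>E UNIV)"

text \<open>The algebraic tensor product of the factor spaces, realised as functions on \<open>cube_T m\<close>.\<close>

definition alg_tensor ::
  "(nat \<Rightarrow> nat \<Rightarrow> real ^ 'd::finite \<Rightarrow> real) \<Rightarrow> real \<Rightarrow> (nat \<Rightarrow> nat \<Rightarrow> real) \<Rightarrow> nat
     \<Rightarrow> ((nat \<Rightarrow> real ^ 'd) \<Rightarrow> real) set" where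
  "alg_tensor P r \<gamma> m = {(\<lambda>x. \<Sum>i<N. \<Prod>j=1..m. h i j (x j)) | (N :: nat) h.
     \<forall>i<N. \<forall>j\<in>{1..m}. h i j \<in> H1_space P r (\<gamma> m j)}"

text \<open>The Hilbert space tensor product is the completion of the algebraic one. For \<open>r > d + 1\<close>
  convergence in \<open>norm_m\<close> implies uniform convergence on \<open>cube_T m\<close>, so the completion consists of
  the continuous functions that are \<open>norm_m\<close>-limits of elements of the algebraic tensor product.\<close>

definition H_space ::
  "(nat \<Rightarrow> nat \<Rightarrow> real ^ 'd::finite \<Rightarrow> real) \<Rightarrow> real \<Rightarrow> (nat \<Rightarrow> nat \<Rightarrow> real) \<Rightarrow> nat
     \<Rightarrow> ((nat \<Rightarrow> real ^ 'd) \<Rightarrow> real) set" where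
  "H_space P r \<gamma> m = {f. continuous_on (cube_T m) f \<and> finite_norm_m P r \<gamma> m f \<and>
     (\<forall>\<epsilon>>0. \<exists>g\<in>alg_tensor P r \<gamma> m.
        finite_norm_m P r \<gamma> m (\<lambda>x. f x - g x) \<and> norm_m P r \<gamma> m (\<lambda>x. f x - g x) < \<epsilon>)}"

definition Q_rule :: "nat \<Rightarrow> (nat \<Rightarrow> nat \<Rightarrow> real ^ 'd::finite) \<Rightarrow> ((nat \<Rightarrow> real ^ 'd) \<Rightarrow> real) \<Rightarrow> real" where
  "Q_rule n t f = 1 / real n * (\<Sum>i=1..n. f (t i))"

text \<open>Taken in the extended reals, so that the supremum is meaningful without a prior proof
  of boundedness.\<close>

definition wce ::
  "(nat \<Rightarrow> nat \<Rightarrow> real ^ 'd::finite \<Rightarrow> real) \<Rightarrow> real \<Rightarrow> (nat \<Rightarrow> nat \<Rightarrow> real) \<Rightarrow> nat \<Rightarrow> nat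
     \<Rightarrow> (nat \<Rightarrow> nat \<Rightarrow> real ^ 'd) \<Rightarrow> ereal" where
  "wce P r \<gamma> n m t =
     (SUP f\<in>{f \<in> H_space P r \<gamma> m. norm_m P r \<gamma> m f \<le> 1}. ereal \<bar>integral_m m f - Q_rule n t f\<bar>)"

end

theory Submission
  imports Defs
begin

text \<open>
  Write \<open>a\<close> for a pair of multi-indices \<open>(l, k)\<close>, \<open>\<phi>\<^sub>a\<close> for the tensor product of the \<open>P (l j) (k j)\<close>
  and \<open>B\<^sub>a\<close> for the corresponding product of weights. An element \<open>f\<close> of the space with
  coefficients \<open>c\<^sub>a\<close> equals \<open>\<Sum> c\<^sub>a \<phi>\<^sub>a\<close> pointwise, and the coefficient at the zero index is the integral
  of \<open>f\<close>. Up to sign, \<open>n\<close> times the quadrature error is thus \<open>\<Sum> c\<^sub>a S\<^sub>a\<close>, where this sum and those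
  below run over the nonzero indices and \<open>S\<^sub>a = \<phi>\<^sub>a(t\<^sub>1) + \<dots> + \<phi>\<^sub>a(t\<^sub>n)\<close>. By the Cauchy-Schwarz
  inequality its square is at most \<open>\<Sum> B\<^sub>a c\<^sub>a\<^sup>2 \<le> 1\<close> times \<open>W = \<Sum> S\<^sub>a\<^sup>2 / B\<^sub>a\<close>, and it suffices to find
  nodes with \<open>W \<le> n C\<close>, where \<open>C\<close> is the bracket in the theorem.

  The nodes are chosen one after the other. Adding a node \<open>s\<close> changes \<open>W\<close> by
  \<open>2 g(s) + \<Sum> \<phi>\<^sub>a(s)\<^sup>2 / B\<^sub>a\<close> with \<open>g = \<Sum> (S\<^sub>a / B\<^sub>a) \<phi>\<^sub>a\<close>. The last sum is the reproducing kernel on the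
  diagonal minus one; the kernel factorises over the coordinates, and the bound on \<open>P_kernel\<close> makes it at
  most \<open>C\<close> at every point (\<open>tensor_diagonal_bound\<close>). The function \<open>g\<close> is continuous with mean zero,
  hence \<open>g(s) \<le> 0\<close> for some \<open>s\<close>, and that \<open>s\<close> is taken (\<open>good_nodes\<close>). This replaces the average over
  all \<open>n\<close>-tuples of nodes by one average at a time.

  The analytic content is the pointwise expansion of \<open>f\<close> (\<open>eq_mean_plus_series\<close>). The bound \<open>C\<close> and the finite norm
  of \<open>f\<close> make the series converge uniformly, so its sum is continuous and has the same coefficients as \<open>f\<close>. A
  continuous function all of whose coefficients vanish is zero, because the span of the \<open>\<phi>\<^sub>a\<close>
  contains all polynomials and is therefore uniformly dense (\<open>tensors_dense\<close>), and because the
  integral of the square of a nonzero continuous function over the cube is positive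
  (\<open>continuous_zero_if_square_integral_zero\<close>).

  The argument about nodes and series uses only a positive definite mean on the continuous functions
  of a compact space and a dense orthonormal system, and is carried out in that generality.
\<close>

section \<open>Linear spans of real functions\<close>

text \<open>
  Built one generator at a time, so that a property preserved by linear combinations passes to the
  span by rule induction, without families of coefficients.
\<close>

inductive_set lspan :: "('a \<Rightarrow> real) set \<Rightarrow> ('a \<Rightarrow> real) set" for G where
  zero: "(\<lambda>x. 0) \<in> lspan G"
| add: "g \<in> G \<Longrightarrow> h \<in> lspan G \<Longrightarrow> (\<lambda>x. c * g x + h x) \<in> lspan G"

lemma lspan_base: "g \<in> G \<Longrightarrow> g \<in> lspan G"
  using lspan.add[OF _ lspan.zero, of g G 1] by simp

lemma lspan_scale: "f \<in> lspan G \<Longrightarrow> (\<lambda>x. c * f x) \<in> lspan G"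
proof (induction rule: lspan.induct)
  case zero
  then show ?case using lspan.zero by simp
next
  case (add g h d)
  then show ?case using lspan.add[OF add.hyps(1) add.IH, of "c * d"] by (simp add: algebra_simps)
qed

lemma lspan_add: "f \<in> lspan G \<Longrightarrow> g \<in> lspan G \<Longrightarrow> (\<lambda>x. f x + g x) \<in> lspan G"
proof (induction rule: lspan.induct)
  case (add f h d)
  then show ?case using lspan.add[OF add.hyps(1) add.IH[OF add.prems], of d] by (simp add: algebra_simps)
qed auto

lemma lspan_sum:
  "finite F \<Longrightarrow> (\<And>i. i \<in> F \<Longrightarrow> f i \<in> lspan G) \<Longrightarrow> (\<lambda>x. \<Sum>i\<in>F. f i x) \<in> lspan G"
proof (induction F rule: finite_induct)
  case empty
  then show ?case by (simp add: lspan.zero)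
next
  case (insert i F)
  then have "(\<lambda>x. f i x + (\<Sum>i\<in>F. f i x)) \<in> lspan G"
    by (intro lspan_add) simp_all
  then show ?case using insert.hyps by simp
qed

lemma lspan_closed:
  assumes "f \<in> lspan G" and "G \<subseteq> lspan G'"
  shows "f \<in> lspan G'"
  using assms
proof (induction rule: lspan.induct)
  case zero
  show ?case by (rule lspan.zero)
next
  case (add g h c)
  show ?case
    by (rule lspan_add[OF lspan_scale add.IH]) (use add in blast)+
qed

lemma lspan_mono: "f \<in> lspan G \<Longrightarrow> G \<subseteq> G' \<Longrightarrow> f \<in> lspan G'"
  by (erule lspan_closed) (auto intro: lspan_base)

lemma continuous_on_lspan:
  assumes "f \<in> lspan G" and "\<And>g. g \<in> G \<Longrightarrow> continuous_on S g"
  shows "continuous_on S f"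
  using assms by (induction rule: lspan.induct) (auto intro!: continuous_intros)

lemma lspan_mult:
  assumes f: "f \<in> lspan G" and g: "g \<in> lspan G'"
    and prod: "\<And>a b. a \<in> G \<Longrightarrow> b \<in> G' \<Longrightarrow> (\<lambda>x. a x * b x) \<in> lspan H"
  shows "(\<lambda>x. f x * g x) \<in> lspan H"
  using f
proof (induction rule: lspan.induct)
  case zero
  show ?case by (simp add: lspan.zero)
next
  case (add a h c)
  have "(\<lambda>x. a x * g x) \<in> lspan H"
    using g
  proof (induction rule: lspan.induct)
    case zero
    show ?case by (simp add: lspan.zero)
  next
    case (add b h d)
    have "(\<lambda>x. d * (a x * b x) + a x * h x) \<in> lspan H"
      by (intro lspan_add[OF lspan_scale add.IH] prod add.hyps \<open>a \<in> G\<close>)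
    then show ?case by (simp add: algebra_simps)
  qed
  then have "(\<lambda>x. c * (a x * g x) + h x * g x) \<in> lspan H"
    by (rule lspan_add[OF lspan_scale add.IH])
  then show ?case by (simp add: algebra_simps)
qed

section \<open>Sums over arbitrary index sets\<close>

lemma summable_if_sums_bounded:
  fixes f :: "'i \<Rightarrow> real"
  assumes "\<And>i. i \<in> I \<Longrightarrow> f i \<ge> 0" and "\<And>F. finite F \<Longrightarrow> F \<subseteq> I \<Longrightarrow> sum f F \<le> b"
  shows "f summable_on I"
proof (rule nonneg_bdd_above_summable_on)
  show "bdd_above (sum f ` {F. F \<subseteq> I \<and> finite F})"
    by (rule bdd_aboveI2[of _ _ b]) (use assms(2) in simp)
qed (rule assms(1))

lemma has_sum_finite_sum:
  fixes f :: "'p \<Rightarrow> 'i \<Rightarrow> real"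
  assumes "finite T" and "\<And>p. p \<in> T \<Longrightarrow> (f p has_sum s p) I"
  shows "((\<lambda>i. \<Sum>p\<in>T. f p i) has_sum (\<Sum>p\<in>T. s p)) I"
  using assms by (induction T rule: finite_induct) (simp_all add: has_sum_0 has_sum_add)

lemma has_sum_abs_le:
  fixes f :: "'i \<Rightarrow> real"
  assumes s: "(f has_sum s) I" and b: "\<And>F. finite F \<Longrightarrow> F \<subseteq> I \<Longrightarrow> \<bar>sum f F\<bar> \<le> b"
  shows "\<bar>s\<bar> \<le> b"
proof (rule abs_leI)
  show "s \<le> b" by (rule has_sum_le_finite_sums[OF s]) (rule abs_le_D1[OF b])
  have "((\<lambda>i. - f i) has_sum - s) I" using s by (rule has_sum_uminusI)
  then show "- s \<le> b"
    by (rule has_sum_le_finite_sums) (use abs_le_D2[OF b] in \<open>simp add: sum_negf\<close>)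
qed

section \<open>Node selection for a weighted orthonormal system\<close>

text \<open>
  The abstract form of a normalised integral over a compact set. Definiteness is what turns
  vanishing in mean square into pointwise vanishing.
\<close>

locale positive_mean =
  fixes S :: "'a::t2_space set" and E :: "('a \<Rightarrow> real) \<Rightarrow> real"
  assumes compact: "compact S"
    and mean_add: "continuous_on S f \<Longrightarrow> continuous_on S g \<Longrightarrow> E (\<lambda>x. f x + g x) = E f + E g"
    and mean_scale: "continuous_on S f \<Longrightarrow> E (\<lambda>x. c * f x) = c * E f"
    and mean_mono: "continuous_on S f \<Longrightarrow> continuous_on S g \<Longrightarrow> (\<And>x. x \<in> S \<Longrightarrow> f x \<le> g x) \<Longrightarrow> E f \<le> E g"
    and mean_one: "E (\<lambda>x. 1) = 1"
    and mean_definite: "continuous_on S f \<Longrightarrow> E (\<lambda>x. f x * f x) = 0 \<Longrightarrow> x \<in> S \<Longrightarrow> f x = 0"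
begin

lemma mean_const: "E (\<lambda>x. c) = c"
  using mean_scale[of "\<lambda>x. 1" c] mean_one by (simp add: continuous_on_const)

lemma nonempty: "S \<noteq> {}"
proof
  assume "S = {}"
  then have "E (\<lambda>x. 1) \<le> E (\<lambda>x. 0)" by (intro mean_mono) auto
  then show False using mean_const by simp
qed

lemma mean_diff:
  assumes "continuous_on S f" "continuous_on S g"
  shows "E (\<lambda>x. f x - g x) = E f - E g"
  using mean_add[OF assms(1), of "\<lambda>x. -1 * g x"] mean_scale[OF assms(2), of "-1"] assms(2)
  by (simp add: continuous_on_minus)

lemma mean_sum:
  "finite F \<Longrightarrow> (\<And>i. i \<in> F \<Longrightarrow> continuous_on S (f i)) \<Longrightarrow> E (\<lambda>x. \<Sum>i\<in>F. f i x) = (\<Sum>i\<in>F. E (f i))"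
proof (induction F rule: finite_induct)
  case (insert i F)
  then show ?case by (simp add: mean_add continuous_on_sum)
qed (simp add: mean_const)

lemma mean_abs_le:
  assumes f: "continuous_on S f" and b: "\<And>x. x \<in> S \<Longrightarrow> \<bar>f x\<bar> \<le> b"
  shows "\<bar>E f\<bar> \<le> b"
proof -
  have "E f \<le> E (\<lambda>x. b)"
    by (rule mean_mono[OF f continuous_on_const]) (rule abs_le_D1[OF b])
  moreover have "E (\<lambda>x. -b) \<le> E f"
    by (rule mean_mono[OF continuous_on_const f]) (use abs_le_D2[OF b] in \<open>simp add: minus_le_iff\<close>)
  ultimately show ?thesis by (simp add: mean_const abs_le_iff)
qed

lemma nonpositive_value:
  assumes g: "continuous_on S g" and "E g \<le> 0"
  shows "\<exists>t\<in>S. g t \<le> 0"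
proof -
  obtain t where t: "t \<in> S" "\<And>x. x \<in> S \<Longrightarrow> g t \<le> g x"
    using continuous_attains_inf[OF compact nonempty g] by blast
  have "E (\<lambda>x. g t) \<le> E g" using t by (intro mean_mono g continuous_on_const)
  then show ?thesis using t(1) assms(2) by (auto simp: mean_const intro!: bexI[of _ t])
qed

end

text \<open>
  The constant function is kept out of the system: the \<open>\<phi> i\<close> have mean zero, and the constant comes
  back only in the density assumption. The sum in \<open>diagonal_bound\<close> is thus the diagonal of the
  reproducing kernel with its constant part removed, and exactly this quantity enters the error
  bound.
\<close>

locale weighted_system = positive_mean S E
  for S :: "'a::t2_space set" and E :: "('a \<Rightarrow> real) \<Rightarrow> real" +
  fixes I :: "'i set" and \<phi> :: "'i \<Rightarrow> 'a \<Rightarrow> real" and B :: "'i \<Rightarrow> real" and C :: real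
  assumes cont: "i \<in> I \<Longrightarrow> continuous_on S (\<phi> i)"
    and mean_zero: "i \<in> I \<Longrightarrow> E (\<phi> i) = 0"
    and orthonormal: "i \<in> I \<Longrightarrow> j \<in> I \<Longrightarrow> E (\<lambda>x. \<phi> i x * \<phi> j x) = (if i = j then 1 else 0)"
    and weight_pos: "i \<in> I \<Longrightarrow> B i > 0"
    and diagonal_bound: "x \<in> S \<Longrightarrow> finite F \<Longrightarrow> F \<subseteq> I \<Longrightarrow> (\<Sum>i\<in>F. (\<phi> i x)\<^sup>2 / B i) \<le> C"
    and dense: "continuous_on S f \<Longrightarrow> e > 0 \<Longrightarrow>
      \<exists>p\<in>lspan (insert (\<lambda>x. 1) (\<phi> ` I)). \<forall>x\<in>S. \<bar>f x - p x\<bar> < e"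
begin

lemma bound_nonneg: "C \<ge> 0"
proof -
  obtain x where "x \<in> S" using nonempty by blast
  then show ?thesis using diagonal_bound[of x "{}"] by simp
qed

text \<open>
  The inequality for \<open>sqrt (B i) * a i\<close> and \<open>b i / sqrt (B i)\<close>.
\<close>

lemma weighted_Cauchy_Schwarz:
  assumes F: "F \<subseteq> I"
  shows "(\<Sum>i\<in>F. a i * b i)\<^sup>2 \<le> (\<Sum>i\<in>F. B i * (a i)\<^sup>2) * (\<Sum>i\<in>F. (b i)\<^sup>2 / B i)"
proof -
  have "(\<Sum>i\<in>F. a i * b i) = (\<Sum>i\<in>F. (sqrt (B i) * a i) * (b i / sqrt (B i)))"
  proof (rule sum.cong)
    fix i assume "i \<in> F"
    then have "sqrt (B i) \<noteq> 0" using weight_pos[of i] F by auto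
    then show "a i * b i = (sqrt (B i) * a i) * (b i / sqrt (B i))" by simp
  qed simp
  also have "\<dots>\<^sup>2 \<le> (\<Sum>i\<in>F. (sqrt (B i) * a i)\<^sup>2) * (\<Sum>i\<in>F. (b i / sqrt (B i))\<^sup>2)"
    by (rule Cauchy_Schwarz_ineq_sum)
  also have "(\<Sum>i\<in>F. (sqrt (B i) * a i)\<^sup>2) = (\<Sum>i\<in>F. B i * (a i)\<^sup>2)"
    by (intro sum.cong) (use F in \<open>auto simp: power_mult_distrib dest!: subsetD[THEN weight_pos]\<close>)
  also have "(\<Sum>i\<in>F. (b i / sqrt (B i))\<^sup>2) = (\<Sum>i\<in>F. (b i)\<^sup>2 / B i)"
    by (intro sum.cong) (use F in \<open>auto simp: power_divide dest!: subsetD[THEN weight_pos]\<close>)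
  finally show ?thesis .
qed

lemma products_summable:
  assumes a: "(\<lambda>i. B i * (a i)\<^sup>2) summable_on I" and b: "(\<lambda>i. (b i)\<^sup>2 / B i) summable_on I"
  shows "(\<lambda>i. a i * b i) summable_on I"
proof -
  have "(\<lambda>i. norm (a i * b i)) summable_on I"
  proof (rule summable_on_comparison_test)
    show "(\<lambda>i. B i * (a i)\<^sup>2 + (b i)\<^sup>2 / B i) summable_on I"
      by (intro summable_on_add a b)
  next
    fix i assume "i \<in> I"
    then have p: "sqrt (B i) > 0" "B i > 0" using weight_pos by auto
    have "0 \<le> (sqrt (B i) * \<bar>a i\<bar> - \<bar>b i\<bar> / sqrt (B i))\<^sup>2" by simp
    also have "\<dots> = B i * (a i)\<^sup>2 + (b i)\<^sup>2 / B i - 2 * (\<bar>a i\<bar> * \<bar>b i\<bar>)"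
      using p by (simp add: power2_diff power_mult_distrib power_divide)
    finally have "2 * (\<bar>a i\<bar> * \<bar>b i\<bar>) \<le> B i * (a i)\<^sup>2 + (b i)\<^sup>2 / B i" by simp
    moreover have "\<bar>a i\<bar> * \<bar>b i\<bar> \<ge> 0" by simp
    ultimately have "\<bar>a i\<bar> * \<bar>b i\<bar> \<le> B i * (a i)\<^sup>2 + (b i)\<^sup>2 / B i" by linarith
    then show "norm (a i * b i) \<le> B i * (a i)\<^sup>2 + (b i)\<^sup>2 / B i"
      by (simp add: abs_mult)
  qed auto
  then show ?thesis by (rule abs_summable_summable)
qed

lemma diagonal_summable:
  assumes "x \<in> S" shows "(\<lambda>i. (\<phi> i x)\<^sup>2 / B i) summable_on I"
  using weight_pos
  by (intro summable_if_sums_bounded[of _ _ C] diagonal_bound assms) (simp_all add: less_imp_le)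

definition series :: "('i \<Rightarrow> real) \<Rightarrow> 'a \<Rightarrow> real" where
  "series c x = (\<Sum>\<^sub>\<infinity>i\<in>I. c i * \<phi> i x)"

lemma series_has_sum:
  assumes c: "(\<lambda>i. B i * (c i)\<^sup>2) summable_on I" and x: "x \<in> S"
  shows "((\<lambda>i. c i * \<phi> i x) has_sum series c x) I"
  unfolding series_def using products_summable[OF c diagonal_summable[OF x]] by simp

text \<open>
  The tail of \<open>\<Sum> B i * (c i)\<^sup>2\<close> is independent of the point, and the Cauchy-Schwarz inequality
  multiplies it by a diagonal sum, which is at most \<open>C\<close> everywhere; hence the tails of the series
  are uniformly small.
\<close>

lemma series_uniform_limit:
  assumes c: "(\<lambda>i. B i * (c i)\<^sup>2) summable_on I"
  shows "uniform_limit S (\<lambda>F x. \<Sum>i\<in>F. c i * \<phi> i x) (series c) (finite_subsets_at_top I)"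
  unfolding uniform_limit_iff
proof safe
  fix e :: real assume e: "e > 0"
  (* A tail below d of the weighted square sum gives a tail of the series below e/2;
     C + 1 replaces C to avoid dividing by zero. *)
  define d where "d = (e/2)\<^sup>2 / (C + 1)"
  have d: "d > 0" using e bound_nonneg by (simp add: d_def)
  define A where "A = (\<Sum>\<^sub>\<infinity>i\<in>I. B i * (c i)\<^sup>2)"
  have "((\<lambda>F. \<Sum>i\<in>F. B i * (c i)\<^sup>2) \<longlongrightarrow> A) (finite_subsets_at_top I)"
    using has_sum_infsum[OF c] by (simp add: A_def has_sum_def)
  then have "\<forall>\<^sub>F F in finite_subsets_at_top I. A - d < (\<Sum>i\<in>F. B i * (c i)\<^sup>2)"
    using d by (intro order_tendstoD) auto
  then show "\<forall>\<^sub>F F in finite_subsets_at_top I. \<forall>x\<in>S. dist (\<Sum>i\<in>F. c i * \<phi> i x) (series c x) < e"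
    using eventually_finite_subsets_at_top_weakI[of I "\<lambda>F. finite F \<and> F \<subseteq> I", simplified]
  proof eventually_elim
    case (elim F)
    show ?case
    proof
      fix x assume x: "x \<in> S"
      have bound: "\<bar>\<Sum>i\<in>G. c i * \<phi> i x\<bar> \<le> e/2" if G: "finite G" "G \<subseteq> I - F" for G
      proof -
        have "(\<Sum>i\<in>F. B i * (c i)\<^sup>2) + (\<Sum>i\<in>G. B i * (c i)\<^sup>2) = (\<Sum>i\<in>F \<union> G. B i * (c i)\<^sup>2)"
          using G elim by (subst sum.union_disjoint) auto
        also have "\<dots> \<le> A" unfolding A_def
          using G elim weight_pos by (intro finite_sum_le_infsum c) (auto simp: less_imp_le)
        finally have "(\<Sum>i\<in>G. B i * (c i)\<^sup>2) \<le> d" using elim by linarith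
        moreover have "(\<Sum>i\<in>G. (\<phi> i x)\<^sup>2 / B i) \<le> C" using diagonal_bound x G by blast
        moreover have "(\<Sum>i\<in>G. c i * \<phi> i x)\<^sup>2 \<le> (\<Sum>i\<in>G. B i * (c i)\<^sup>2) * (\<Sum>i\<in>G. (\<phi> i x)\<^sup>2 / B i)"
          using G by (intro weighted_Cauchy_Schwarz) auto
        moreover have "(\<Sum>i\<in>G. (\<phi> i x)\<^sup>2 / B i) \<ge> 0"
          using G weight_pos by (intro sum_nonneg) (force simp: less_imp_le)
        ultimately have "(\<Sum>i\<in>G. c i * \<phi> i x)\<^sup>2 \<le> d * C"
          using d by (smt (verit) mult_mono)
        also have "\<dots> \<le> d * (C + 1)" using d by simp
        also have "\<dots> = (e/2)\<^sup>2" using bound_nonneg by (simp add: d_def)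
        finally show ?thesis using e by (simp add: abs_le_square_iff[symmetric])
      qed
      let ?R = "series c x - (\<Sum>i\<in>F. c i * \<phi> i x)"
      have R: "((\<lambda>i. c i * \<phi> i x) has_sum ?R) (I - F)"
        using elim by (intro has_sum_Diff series_has_sum c x has_sum_finite) auto
      have "\<bar>?R\<bar> \<le> e/2"
        by (rule has_sum_abs_le[OF R bound])
      then show "dist (\<Sum>i\<in>F. c i * \<phi> i x) (series c x) < e"
        using e by (simp add: dist_real_def abs_minus_commute)
    qed
  qed
qed

lemma series_continuous:
  assumes c: "(\<lambda>i. B i * (c i)\<^sup>2) summable_on I"
  shows "continuous_on S (series c)"
proof (rule uniform_limit_theorem[OF _ series_uniform_limit[OF c]])
  show "\<forall>\<^sub>F F in finite_subsets_at_top I. continuous_on S (\<lambda>x. \<Sum>i\<in>F. c i * \<phi> i x)"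
    by (rule eventually_finite_subsets_at_top_weakI) (auto intro!: continuous_intros cont)
qed auto

text \<open>
  Integration term by term, by uniform convergence. Taking \<open>h = 1\<close> gives the mean of a series,
  taking \<open>h = \<phi> j\<close> its coefficients.
\<close>

lemma mean_series_mult:
  assumes c: "(\<lambda>i. B i * (c i)\<^sup>2) summable_on I" and h: "continuous_on S h"
  shows "((\<lambda>i. c i * E (\<lambda>x. \<phi> i x * h x)) has_sum E (\<lambda>x. series c x * h x)) I"
  unfolding has_sum_def
proof (rule tendstoI)
  fix e :: real assume e: "e > 0"
  obtain H where H: "\<And>x. x \<in> S \<Longrightarrow> \<bar>h x\<bar> \<le> H" "H > 0"
  proof -
    obtain b where "\<forall>y\<in>h ` S. norm y \<le> b"
      using compact_imp_bounded[OF compact_continuous_image[OF h compact]] bounded_iff by blast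
    then show thesis by (intro that[of "max b 1"]) force+
  qed
  have "\<forall>\<^sub>F F in finite_subsets_at_top I. \<forall>x\<in>S. dist (\<Sum>i\<in>F. c i * \<phi> i x) (series c x) < e / (2 * H)"
    using series_uniform_limit[OF c] e H(2) unfolding uniform_limit_iff by simp
  then show "\<forall>\<^sub>F F in finite_subsets_at_top I.
      dist (\<Sum>i\<in>F. c i * E (\<lambda>x. \<phi> i x * h x)) (E (\<lambda>x. series c x * h x)) < e"
    using eventually_finite_subsets_at_top_weakI[of I "\<lambda>F. finite F \<and> F \<subseteq> I", simplified]
  proof eventually_elim
    case (elim F)
    then have cF: "continuous_on S (\<phi> i)" if "i \<in> F" for i using cont that by auto
    have "(\<Sum>i\<in>F. c i * E (\<lambda>x. \<phi> i x * h x)) = E (\<lambda>x. \<Sum>i\<in>F. c i * (\<phi> i x * h x))"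
      using elim cF by (subst mean_sum) (auto intro!: continuous_intros h mean_scale[symmetric] sum.cong)
    also have "\<dots> = E (\<lambda>x. (\<Sum>i\<in>F. c i * \<phi> i x) * h x)"
      by (simp add: sum_distrib_right mult.assoc)
    also have "\<dots> - E (\<lambda>x. series c x * h x)
        = E (\<lambda>x. (\<Sum>i\<in>F. c i * \<phi> i x) * h x - series c x * h x)"
      using cF by (intro mean_diff[symmetric] continuous_intros h series_continuous c) auto
    also have "\<bar>\<dots>\<bar> \<le> e / 2"
    proof (rule mean_abs_le)
      show "continuous_on S (\<lambda>x. (\<Sum>i\<in>F. c i * \<phi> i x) * h x - series c x * h x)"
        using cF by (intro continuous_intros h series_continuous c) auto
      fix x assume x: "x \<in> S"
      have "\<bar>(\<Sum>i\<in>F. c i * \<phi> i x) * h x - series c x * h x\<bar>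
          = \<bar>(\<Sum>i\<in>F. c i * \<phi> i x) - series c x\<bar> * \<bar>h x\<bar>"
        by (simp add: left_diff_distrib[symmetric] abs_mult)
      also have "\<dots> \<le> e / (2 * H) * H"
        using elim x H by (intro mult_mono) (auto simp: dist_real_def less_imp_le)
      finally show "\<bar>(\<Sum>i\<in>F. c i * \<phi> i x) * h x - series c x * h x\<bar> \<le> e / 2"
        using H(2) by simp
    qed
    finally show ?case using e by (simp add: dist_real_def)
  qed
qed

lemma mean_series:
  assumes c: "(\<lambda>i. B i * (c i)\<^sup>2) summable_on I"
  shows "E (series c) = 0"
proof -
  have "((\<lambda>i. c i * E (\<lambda>x. \<phi> i x * 1)) has_sum E (\<lambda>x. series c x * 1)) I"
    by (intro mean_series_mult c continuous_on_const)
  moreover have "((\<lambda>i. c i * E (\<lambda>x. \<phi> i x * 1)) has_sum 0) I"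
    by (intro has_sum_0) (simp add: mean_zero)
  ultimately have "E (\<lambda>x. series c x * 1) = 0" using has_sum_unique by blast
  then show ?thesis by simp
qed

lemma series_coefficient:
  assumes c: "(\<lambda>i. B i * (c i)\<^sup>2) summable_on I" and j: "j \<in> I"
  shows "E (\<lambda>x. series c x * \<phi> j x) = c j"
proof -
  have "((\<lambda>i. c i * E (\<lambda>x. \<phi> i x * \<phi> j x)) has_sum c j) I"
  proof -
    have "((\<lambda>i. c i) has_sum c j) {j}" using has_sum_finite[of "{j}" c] by simp
    then show ?thesis
      by (rule has_sum_cong_neutral[THEN iffD1, rotated -1]) (use j orthonormal in auto)
  qed
  then show ?thesis
    using mean_series_mult[OF c cont[OF j]] has_sum_unique by blast
qed

text \<open>
  If \<open>p\<close> in the span approximates \<open>h\<close> uniformly, then the mean of \<open>h\<^sup>2\<close> equals that of \<open>h (h - p)\<close>,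
  which is small. So the mean of \<open>h\<^sup>2\<close> is zero.
\<close>

lemma orthogonal_to_all_is_zero:
  assumes h: "continuous_on S h" and "E h = 0" and "\<And>i. i \<in> I \<Longrightarrow> E (\<lambda>x. h x * \<phi> i x) = 0"
    and x: "x \<in> S"
  shows "h x = 0"
proof (rule mean_definite[OF h _ x])
  let ?G = "insert (\<lambda>x. 1) (\<phi> ` I)"
  have G: "continuous_on S g \<and> E (\<lambda>x. h x * g x) = 0" if "g \<in> ?G" for g
    using that assms cont by auto
  have span: "continuous_on S p \<and> E (\<lambda>x. h x * p x) = 0" if "p \<in> lspan ?G" for p
    using that
  proof induction
    case zero
    then show ?case by (simp add: mean_const)
  next
    case (add g q c)
    note g = G[OF add.hyps(1)]
    have "E (\<lambda>x. c * (h x * g x) + h x * q x) = c * E (\<lambda>x. h x * g x) + E (\<lambda>x. h x * q x)"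
      using g add.IH h
      by (simp only: mean_add mean_scale continuous_on_mult continuous_on_mult_left)
    then have "E (\<lambda>x. h x * (c * g x + q x)) = 0"
      using g add.IH by (simp add: algebra_simps)
    then show ?case using add.IH g by (auto intro!: continuous_intros)
  qed
  obtain H where H: "\<And>x. x \<in> S \<Longrightarrow> \<bar>h x\<bar> \<le> H" "H > 0"
  proof -
    obtain b where "\<forall>y\<in>h ` S. norm y \<le> b"
      using compact_imp_bounded[OF compact_continuous_image[OF h compact]] bounded_iff by blast
    then show thesis by (intro that[of "max b 1"]) force+
  qed
  have small: "\<bar>E (\<lambda>x. h x * h x)\<bar> \<le> 0 + e" if e: "e > 0" for e
  proof -
    obtain p where p: "p \<in> lspan ?G" "\<And>x. x \<in> S \<Longrightarrow> \<bar>h x - p x\<bar> < e / H"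
      using dense[OF h, of "e / H"] e H(2) by auto
    have "E (\<lambda>x. h x * h x) = E (\<lambda>x. h x * (h x - p x))"
      using span[OF p(1)] h by (simp add: right_diff_distrib mean_diff continuous_on_mult)
    also have "\<bar>\<dots>\<bar> \<le> e"
    proof (rule mean_abs_le)
      show "continuous_on S (\<lambda>x. h x * (h x - p x))"
        using span[OF p(1)] h by (auto intro!: continuous_intros)
      fix x assume x: "x \<in> S"
      have "\<bar>h x * (h x - p x)\<bar> \<le> H * (e / H)"
        unfolding abs_mult using H p(2) x by (intro mult_mono) (auto simp: less_imp_le)
      then show "\<bar>h x * (h x - p x)\<bar> \<le> e" using H(2) by simp
    qed
    finally show ?thesis by simp
  qed
  have "\<bar>E (\<lambda>x. h x * h x)\<bar> \<le> 0" by (rule field_le_epsilon) (rule small)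
  then show "E (\<lambda>x. h x * h x) = 0" by simp
qed

text \<open>
  The difference of the two sides is continuous and orthogonal to the constants and to all \<open>\<phi> i\<close>.
\<close>

lemma eq_mean_plus_series:
  assumes f: "continuous_on S f" and c: "(\<lambda>i. B i * (E (\<lambda>x. f x * \<phi> i x))\<^sup>2) summable_on I"
    and x: "x \<in> S"
  shows "f x = E f + series (\<lambda>i. E (\<lambda>x. f x * \<phi> i x)) x"
proof -
  let ?g = "series (\<lambda>i. E (\<lambda>x. f x * \<phi> i x))"
  let ?h = "\<lambda>x. (f x - E f) - ?g x"
  note g = series_continuous[OF c]
  have "?h x = 0"
  proof (rule orthogonal_to_all_is_zero[OF _ _ _ x])
    show "continuous_on S ?h" by (intro continuous_intros f g)
    show "E ?h = 0"
      using f g by (simp add: mean_diff mean_const mean_series[OF c] continuous_on_diff)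
    fix i assume i: "i \<in> I"
    have "E (\<lambda>x. ?h x * \<phi> i x)
        = E (\<lambda>x. (f x * \<phi> i x - E f * \<phi> i x) - ?g x * \<phi> i x)"
      by (simp add: algebra_simps)
    also have "\<dots> = 0"
      using f g cont[OF i]
      by (simp add: mean_diff mean_scale mean_zero[OF i] series_coefficient[OF c i]
          continuous_on_diff continuous_on_mult continuous_on_const)
    finally show "E (\<lambda>x. ?h x * \<phi> i x) = 0" .
  qed
  then show ?thesis by simp
qed

definition node_sum :: "nat \<Rightarrow> (nat \<Rightarrow> 'a) \<Rightarrow> 'i \<Rightarrow> real" where
  "node_sum n t i = (\<Sum>p=1..n. \<phi> i (t p))"

text \<open>
  The greedy choice. With \<open>c i = node_sum n t i / B i\<close>, a further node \<open>s\<close> adds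
  \<open>2 * series c s\<close> and a diagonal term to the weighted square sum. The diagonal term is at most \<open>C\<close>,
  and \<open>series c\<close> has mean zero, so it is nonpositive at some point.
\<close>

lemma good_nodes:
  "\<exists>t. (\<forall>p\<in>{1..n}. t p \<in> S) \<and> (\<lambda>i. (node_sum n t i)\<^sup>2 / B i) summable_on I \<and>
     (\<Sum>\<^sub>\<infinity>i\<in>I. (node_sum n t i)\<^sup>2 / B i) \<le> real n * C"
proof (induction n)
  case 0
  then show ?case by (simp add: node_sum_def)
next
  case (Suc n)
  then obtain t where t: "\<And>p. p \<in> {1..n} \<Longrightarrow> t p \<in> S"
    and summ: "(\<lambda>i. (node_sum n t i)\<^sup>2 / B i) summable_on I"
    and le: "(\<Sum>\<^sub>\<infinity>i\<in>I. (node_sum n t i)\<^sup>2 / B i) \<le> real n * C" by blast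
  define c where "c i = node_sum n t i / B i" for i
  have c: "(\<lambda>i. B i * (c i)\<^sup>2) summable_on I"
    using summ
  proof (rule summable_on_cong[THEN iffD1, rotated])
    fix i assume "i \<in> I"
    then show "(node_sum n t i)\<^sup>2 / B i = B i * (c i)\<^sup>2"
      using weight_pos[of i] by (simp add: c_def power2_eq_square)
  qed
  obtain s where s: "s \<in> S" "series c s \<le> 0"
    using nonpositive_value[OF series_continuous[OF c]] mean_series[OF c] by auto
  define t' where "t' = t(Suc n := s)"
  have ns: "node_sum (Suc n) t' i = node_sum n t i + \<phi> i s" for i
    by (simp add: node_sum_def t'_def)
  have "((\<lambda>i. (node_sum n t i)\<^sup>2 / B i + 2 * (c i * \<phi> i s) + (\<phi> i s)\<^sup>2 / B i) has_sum
      (\<Sum>\<^sub>\<infinity>i\<in>I. (node_sum n t i)\<^sup>2 / B i) + 2 * series c s + (\<Sum>\<^sub>\<infinity>i\<in>I. (\<phi> i s)\<^sup>2 / B i)) I"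
    (is "(_ has_sum ?v) I")
    using summ diagonal_summable[OF s(1)]
    by (intro has_sum_add has_sum_cmult_right series_has_sum c s) auto
  then have hs: "((\<lambda>i. (node_sum (Suc n) t' i)\<^sup>2 / B i) has_sum ?v) I"
    by (rule has_sum_cong[THEN iffD1, rotated])
      (simp add: ns c_def power2_sum add_divide_distrib)
  have "(\<Sum>\<^sub>\<infinity>i\<in>I. (\<phi> i s)\<^sup>2 / B i) \<le> C"
    by (intro infsum_le_finite_sums diagonal_summable s diagonal_bound)
  then have "?v \<le> real (Suc n) * C" using le s by (simp add: algebra_simps)
  moreover have "\<forall>p\<in>{1..Suc n}. t' p \<in> S" using t s by (auto simp: t'_def)
  ultimately show ?case
    using infsumI[OF hs] has_sum_imp_summable[OF hs] by metis
qed

text \<open>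
  The hypothesis on \<open>f\<close> says that its weighted norm, without the constant part, is at most one.
\<close>

theorem exists_nodes_small_error:
  "\<exists>t. (\<forall>p\<in>{1..n}. t p \<in> S) \<and>
     (\<forall>f. continuous_on S f \<longrightarrow>
        (\<forall>F. finite F \<longrightarrow> F \<subseteq> I \<longrightarrow> (\<Sum>i\<in>F. B i * (E (\<lambda>x. f x * \<phi> i x))\<^sup>2) \<le> 1) \<longrightarrow>
        \<bar>(\<Sum>p=1..n. f (t p)) - real n * E f\<bar> \<le> sqrt (real n * C))"
proof -
  obtain t where t: "\<And>p. p \<in> {1..n} \<Longrightarrow> t p \<in> S"
    and summ: "(\<lambda>i. (node_sum n t i)\<^sup>2 / B i) summable_on I"
    and le: "(\<Sum>\<^sub>\<infinity>i\<in>I. (node_sum n t i)\<^sup>2 / B i) \<le> real n * C"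
    using good_nodes by blast
  show ?thesis
  proof (intro exI conjI ballI allI impI)
    fix f assume f: "continuous_on S f"
      and F: "\<forall>F. finite F \<longrightarrow> F \<subseteq> I \<longrightarrow> (\<Sum>i\<in>F. B i * (E (\<lambda>x. f x * \<phi> i x))\<^sup>2) \<le> 1"
    define a where "a i = E (\<lambda>x. f x * \<phi> i x)" for i
    have a: "(\<lambda>i. B i * (a i)\<^sup>2) summable_on I"
      using weight_pos F unfolding a_def
      by (intro summable_if_sums_bounded[of _ _ 1]) (simp_all add: less_imp_le)
    have "f (t p) = E f + series a (t p)" if "p \<in> {1..n}" for p
      using eq_mean_plus_series[OF f a[unfolded a_def] t[OF that]] by (simp add: a_def[abs_def])
    then have eq: "(\<Sum>p=1..n. f (t p)) - real n * E f = (\<Sum>p=1..n. series a (t p))"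
      by (simp add: sum.distrib)
    have hs: "((\<lambda>i. a i * node_sum n t i) has_sum (\<Sum>p=1..n. series a (t p))) I"
      unfolding node_sum_def sum_distrib_left
      by (intro has_sum_finite_sum series_has_sum a t) simp
    have bound: "\<bar>\<Sum>i\<in>F. a i * node_sum n t i\<bar> \<le> sqrt (real n * C)"
      if "finite F" "F \<subseteq> I" for F
    proof -
      have "(\<Sum>i\<in>F. a i * node_sum n t i)\<^sup>2
          \<le> (\<Sum>i\<in>F. B i * (a i)\<^sup>2) * (\<Sum>i\<in>F. (node_sum n t i)\<^sup>2 / B i)"
        by (intro weighted_Cauchy_Schwarz that)
      also have "\<dots> \<le> 1 * (\<Sum>\<^sub>\<infinity>i\<in>I. (node_sum n t i)\<^sup>2 / B i)"
        using F that weight_pos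
        by (intro mult_mono finite_sum_le_infsum summ sum_nonneg)
          (auto simp: a_def less_imp_le subset_iff)
      finally have "(\<Sum>i\<in>F. a i * node_sum n t i)\<^sup>2 \<le> real n * C" using le by simp
      then show ?thesis using real_le_rsqrt[of "\<bar>\<Sum>i\<in>F. a i * node_sum n t i\<bar>"] by simp
    qed
    have "\<bar>\<Sum>p=1..n. series a (t p)\<bar> \<le> sqrt (real n * C)"
      by (rule has_sum_abs_le[OF hs bound])
    then show "\<bar>(\<Sum>p=1..n. f (t p)) - real n * E f\<bar> \<le> sqrt (real n * C)"
      unfolding eq .
  qed (use t in auto)
qed

end

section \<open>Integration on the simplex\<close>

lemma closed_simplex: "closed (simplex_T :: (real ^ 'd::finite) set)"
proof -
  have "simplex_T = (\<Inter>i. {x :: real ^ 'd. 0 \<le> x $ i}) \<inter> {x. 0 \<le> 1 - (\<Sum>i\<in>UNIV. x $ i)}"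
    by (auto simp: simplex_T_def)
  also have "closed \<dots>"
    by (intro closed_Int closed_INT ballI closed_Collect_le continuous_intros)
  finally show ?thesis .
qed

lemma compact_simplex: "compact (simplex_T :: (real ^ 'd::finite) set)"
proof -
  have "simplex_T \<subseteq> cbox (0 :: real ^ 'd) 1"
  proof
    fix x :: "real ^ 'd" assume x: "x \<in> simplex_T"
    have "x $ i \<le> 1" for i
    proof -
      have "x $ i \<le> (\<Sum>i\<in>UNIV. x $ i)"
        using x by (intro member_le_sum) (auto simp: simplex_T_def)
      then show ?thesis using x by (simp add: simplex_T_def)
    qed
    then show "x \<in> cbox 0 1" using x by (simp add: mem_box_cart simplex_T_def)
  qed
  then show ?thesis
    using closed_simplex bounded_subset[OF bounded_cbox] compact_eq_bounded_closed by blast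
qed

text \<open>
  This makes every relatively open nonempty part of the simplex have positive volume.
\<close>

lemma simplex_subset_closure_interior:
  "simplex_T \<subseteq> closure (interior (simplex_T :: (real ^ 'd::finite) set))"
proof -
  let ?U = "{x :: real ^ 'd. \<forall>i. 0 < x $ i} \<inter> {x. 0 < 1 - (\<Sum>i\<in>UNIV. x $ i)}"
  have "?U = (\<Inter>i. {x :: real ^ 'd. 0 < x $ i}) \<inter> {x. 0 < 1 - (\<Sum>i\<in>UNIV. x $ i)}"
    by auto
  also have "open \<dots>"
    by (intro open_Int open_INT ballI open_Collect_less continuous_intros) auto
  finally have "?U \<subseteq> interior simplex_T"
    by (intro interior_maximal) (auto simp: simplex_T_def less_imp_le)
  moreover have "(\<chi> i. 1 / (real CARD('d) + 1)) \<in> ?U"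
    by (auto simp: field_simps)
  ultimately have "interior (simplex_T :: (real ^ 'd) set) \<noteq> {}" by blast
  moreover have "convex (simplex_T :: (real ^ 'd) set)"
  proof (rule convexI)
    fix x y :: "real ^ 'd" and u v :: real
    assume *: "x \<in> simplex_T" "y \<in> simplex_T" "0 \<le> u" "0 \<le> v" "u + v = 1"
    have "u * (\<Sum>i\<in>UNIV. x $ i) + v * (\<Sum>i\<in>UNIV. y $ i) \<le> u * 1 + v * 1"
      using * by (intro add_mono mult_left_mono) (auto simp: simplex_T_def)
    then show "u *\<^sub>R x + v *\<^sub>R y \<in> simplex_T"
      using * by (auto simp: simplex_T_def sum.distrib sum_distrib_left)
  qed
  ultimately show ?thesis
    using convex_closure_interior closure_subset by metis
qed

lemma simplex_integrable:
  fixes f :: "real ^ 'd::finite \<Rightarrow> real"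
  assumes "continuous_on simplex_T f"
  shows "set_integrable lborel simplex_T f"
  unfolding set_integrable_def
  by (rule borel_integrable_compact[OF compact_simplex assms])

lemma inner_T_commute: "inner_T f g = inner_T g f"
  by (simp add: inner_T_def mult.commute)

lemma inner_T_add_left:
  assumes "continuous_on simplex_T f" "continuous_on simplex_T g" "continuous_on simplex_T h"
  shows "inner_T (\<lambda>x. f x + g x) h = inner_T f h + inner_T g h"
  using assms
  by (simp add: inner_T_def distrib_right set_integral_add simplex_integrable
      continuous_on_mult distrib_left)

lemma inner_T_scale_left: "inner_T (\<lambda>x. c * f x) h = c * inner_T f h"
  by (simp add: inner_T_def mult.assoc)

lemma inner_T_zero_left: "inner_T (\<lambda>x. 0) h = 0"
  by (simp add: inner_T_def)

lemma inner_T_sum_left: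
  assumes "finite F" "\<And>i. i \<in> F \<Longrightarrow> continuous_on simplex_T (f i)" "continuous_on simplex_T h"
  shows "inner_T (\<lambda>x. \<Sum>i\<in>F. f i x) h = (\<Sum>i\<in>F. inner_T (f i) h)"
  using assms
proof (induction F rule: finite_induct)
  case (insert i F)
  then have "inner_T (\<lambda>x. f i x + (\<Sum>i\<in>F. f i x)) h = inner_T (f i) h + inner_T (\<lambda>x. \<Sum>i\<in>F. f i x) h"
    by (intro inner_T_add_left continuous_on_sum) auto
  then show ?case using insert by simp
qed (simp add: inner_T_zero_left)

section \<open>Polynomials and the orthonormal basis\<close>

definition monomial :: "('d \<Rightarrow> nat) \<Rightarrow> real ^ 'd::finite \<Rightarrow> real" where
  "monomial \<alpha> x = (\<Prod>i\<in>UNIV. (x $ i) ^ \<alpha> i)"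

lemma continuous_on_monomial: "continuous_on S (monomial \<alpha>)"
  unfolding monomial_def[abs_def] by (intro continuous_intros)

lemma finite_exponents: "finite {\<alpha> :: 'd::finite \<Rightarrow> nat. (\<Sum>i\<in>UNIV. \<alpha> i) \<le> l}"
proof (rule finite_subset)
  show "{\<alpha> :: 'd \<Rightarrow> nat. (\<Sum>i\<in>UNIV. \<alpha> i) \<le> l} \<subseteq> (\<Pi>\<^sub>E i\<in>UNIV. {..l})"
  proof safe
    fix \<alpha> :: "'d \<Rightarrow> nat" and i assume "(\<Sum>i\<in>UNIV. \<alpha> i) \<le> l"
    moreover have "\<alpha> i \<le> (\<Sum>i\<in>UNIV. \<alpha> i)" by (intro member_le_sum) auto
    ultimately show "\<alpha> i \<le> l" by simp
  qed auto
  show "finite (\<Pi>\<^sub>E i\<in>(UNIV :: 'd set). {..l})" by (intro finite_PiE) auto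
qed

lemma polys_le_eq_lspan:
  "polys_le l = lspan (monomial ` {\<alpha> :: 'd::finite \<Rightarrow> nat. (\<Sum>i\<in>UNIV. \<alpha> i) \<le> l})"
    (is "_ = lspan (monomial ` ?A)")
proof safe
  fix p :: "real ^ 'd \<Rightarrow> real" assume "p \<in> polys_le l"
  then obtain c where p: "p = (\<lambda>x. \<Sum>\<alpha>\<in>?A. c \<alpha> * monomial \<alpha> x)"
    by (auto simp: polys_le_def monomial_def)
  show "p \<in> lspan (monomial ` ?A)"
    unfolding p by (intro lspan_sum lspan_scale lspan_base finite_exponents imageI)
next
  fix p :: "real ^ 'd \<Rightarrow> real" assume "p \<in> lspan (monomial ` ?A)"
  then have "\<exists>c. p = (\<lambda>x. \<Sum>\<alpha>\<in>?A. c \<alpha> * monomial \<alpha> x)"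
  proof (induction rule: lspan.induct)
    case zero
    show ?case by (rule exI[of _ "\<lambda>_. 0"]) simp
  next
    case (add g h d)
    then obtain c \<beta> where h: "h = (\<lambda>x. \<Sum>\<alpha>\<in>?A. c \<alpha> * monomial \<alpha> x)"
      and \<beta>: "\<beta> \<in> ?A" "g = monomial \<beta>" by blast
    have "(\<Sum>\<alpha>\<in>?A. (c \<alpha> + (if \<alpha> = \<beta> then d else 0)) * monomial \<alpha> x) = d * g x + h x" for x
    proof -
      have "(\<Sum>\<alpha>\<in>?A. (if \<alpha> = \<beta> then d else 0) * monomial \<alpha> x)
          = (\<Sum>\<alpha>\<in>?A. if \<alpha> = \<beta> then d * monomial \<alpha> x else 0)"
        by (intro sum.cong) auto
      also have "\<dots> = d * g x"
        using \<beta> by (subst sum.delta[OF finite_exponents]) auto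
      finally show ?thesis by (simp add: h distrib_right sum.distrib)
    qed
    then show ?case by (intro exI[of _ "\<lambda>\<alpha>. c \<alpha> + (if \<alpha> = \<beta> then d else 0)"]) simp
  qed
  then show "p \<in> polys_le l" by (simp add: polys_le_def monomial_def)
qed

lemma polys_le_mono: "p \<in> polys_le k \<Longrightarrow> k \<le> l \<Longrightarrow> p \<in> polys_le l"
  unfolding polys_le_eq_lspan by (erule lspan_mono) auto

lemma continuous_on_poly: "p \<in> polys_le l \<Longrightarrow> continuous_on S p"
  unfolding polys_le_eq_lspan by (erule continuous_on_lspan) (auto intro: continuous_on_monomial)

lemma polys_le_mult:
  "p \<in> polys_le k \<Longrightarrow> q \<in> polys_le l \<Longrightarrow> (\<lambda>x. p x * q x) \<in> polys_le (k + l)"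
  unfolding polys_le_eq_lspan
proof (erule (1) lspan_mult, clarify)
  fix \<alpha> \<beta> :: "'a \<Rightarrow> nat"
  assume "(\<Sum>i\<in>UNIV. \<alpha> i) \<le> k" "(\<Sum>i\<in>UNIV. \<beta> i) \<le> l"
  moreover have "(\<lambda>x. monomial \<alpha> x * monomial \<beta> x) = monomial (\<lambda>i. \<alpha> i + \<beta> i)"
    by (auto simp: monomial_def power_add prod.distrib)
  ultimately show "(\<lambda>x. monomial \<alpha> x * monomial \<beta> x)
      \<in> lspan (monomial ` {\<alpha>. (\<Sum>i\<in>UNIV. \<alpha> i) \<le> k + l})"
    by (auto intro!: lspan_base simp: sum.distrib)
qed

lemma const_poly: "(\<lambda>x. 1) \<in> polys_le 0"
proof -
  have "(\<lambda>x. 1) = monomial (\<lambda>_. 0)" by (auto simp: monomial_def)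
  then show ?thesis unfolding polys_le_eq_lspan by (auto intro!: lspan_base)
qed

lemma coordinate_poly: "(\<lambda>x. x $ i) \<in> polys_le 1"
proof -
  have "(\<lambda>x. x $ i) = monomial (\<lambda>k. if k = i then 1 else 0)"
    by (rule ext, simp add: monomial_def if_distrib[of "\<lambda>n. _ ^ n"] prod.delta cong: if_cong)
  then show ?thesis unfolding polys_le_eq_lspan by (auto intro!: lspan_base simp: sum.delta)
qed

locale simplex_basis =
  fixes P :: "nat \<Rightarrow> nat \<Rightarrow> real ^ 'd::finite \<Rightarrow> real"
  assumes basis: "is_ONB_family P" and first: "P 0 1 = (\<lambda>x. 1)"
begin

lemma in_V_space: "k \<in> {1..r_dim CARD('d) l} \<Longrightarrow> P l k \<in> V_space l"
  using basis unfolding is_ONB_family_def by blast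

lemma in_polys_le: "k \<in> {1..r_dim CARD('d) l} \<Longrightarrow> P l k \<in> polys_le l"
  using in_V_space unfolding V_space_def by blast

lemma continuous_basis: "k \<in> {1..r_dim CARD('d) l} \<Longrightarrow> continuous_on S (P l k)"
  using in_polys_le continuous_on_poly by blast

lemma inner_basis:
  assumes "k \<in> {1..r_dim CARD('d) l}" "k' \<in> {1..r_dim CARD('d) l'}"
  shows "inner_T (P l k) (P l' k') = (if l = l' \<and> k = k' then 1 else 0)"
proof (cases l l' rule: linorder_cases)
  case less
  then have "inner_T (P l' k') (P l k) = 0"
    using in_V_space[OF assms(2)] in_polys_le[OF assms(1)] unfolding V_space_def by blast
  then show ?thesis using less by (simp add: inner_T_commute)
next
  case equal
  then show ?thesis using basis assms unfolding is_ONB_family_def by auto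
next
  case greater
  then have "inner_T (P l k) (P l' k') = 0"
    using in_V_space[OF assms(1)] in_polys_le[OF assms(2)] unfolding V_space_def by blast
  then show ?thesis using greater by simp
qed

lemma dims_zero: "{1..r_dim CARD('d) 0} = {1}"
  by (simp add: r_dim_def)

definition basis_upto :: "nat \<Rightarrow> (real ^ 'd \<Rightarrow> real) set" where
  "basis_upto l = (\<lambda>(l', k). P l' k) ` (SIGMA l':{..l}. {1..r_dim CARD('d) l'})"

text \<open>
  Subtract from \<open>p\<close> its orthogonal projection onto the basis functions of lower degree. By induction
  these span all polynomials of lower degree, so the remainder is in \<open>V_space l\<close>, which
  is spanned by the \<open>P l k\<close>.
\<close>

lemma polys_le_subset_lspan_basis: "polys_le l \<subseteq> lspan (basis_upto l)"
proof (induction l rule: less_induct)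
  case (less l)
  show ?case
  proof
    fix p :: "real ^ 'd \<Rightarrow> real" assume p: "p \<in> polys_le l"
    define A where "A = (SIGMA l':{..<l}. {1..r_dim CARD('d) l'})"
    define Q where "Q = (\<lambda>(l', k). P l' k)"
    define c where "c a = inner_T p (Q a)" for a
    define s where "s x = (\<Sum>a\<in>A. c a * Q a x)" for x
    define q where "q x = p x + -1 * s x" for x
    have finA: "finite A" by (simp add: A_def)
    have Q: "Q a \<in> polys_le l" "continuous_on simplex_T (Q a)" if "a \<in> A" for a
      using that polys_le_mono[OF in_polys_le, of "snd a" "fst a" l]
        continuous_basis[of "snd a" "fst a"]
      by (auto simp: A_def Q_def split: prod.splits)
    have inner_QQ: "inner_T (Q a) (Q b) = (if a = b then 1 else 0)" if "a \<in> A" "b \<in> A" for a b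
      using that inner_basis by (auto simp: A_def Q_def split: prod.splits)
    have s: "s \<in> polys_le l"
      unfolding s_def[abs_def] using Q unfolding polys_le_eq_lspan
      by (intro lspan_sum lspan_scale finA)
    have q: "q \<in> polys_le l"
      using p s unfolding q_def[abs_def] polys_le_eq_lspan by (intro lspan_add lspan_scale)
    have cont: "continuous_on simplex_T p" "continuous_on simplex_T q" "continuous_on simplex_T s"
      using p q s continuous_on_poly by blast+
    have ortho_basis: "inner_T (Q b) q = 0" if b: "b \<in> A" for b
    proof -
      have "inner_T s (Q b) = (\<Sum>a\<in>A. c a * inner_T (Q a) (Q b))"
        unfolding s_def[abs_def] using Q b
        by (subst inner_T_sum_left) (auto simp: finA inner_T_scale_left intro!: continuous_intros)
      also have "\<dots> = (\<Sum>a\<in>A. if a = b then c a else 0)"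
        by (intro sum.cong) (auto simp: inner_QQ b)
      also have "\<dots> = c b" using b finA by simp
      finally have "inner_T q (Q b) = 0"
        unfolding q_def[abs_def] using cont Q[OF b]
        by (simp only: inner_T_add_left inner_T_scale_left continuous_on_mult_left c_def)
      then show ?thesis by (simp add: inner_T_commute)
    qed
    have base: "P l' k \<in> lspan (basis_upto l)" if "l' \<le> l" "k \<in> {1..r_dim CARD('d) l'}" for l' k
      using that by (intro lspan_base) (auto simp: basis_upto_def intro!: rev_image_eqI[of "(l', k)"])
    have "inner_T u q = 0" if "k < l" "u \<in> polys_le k" for k u
    proof -
      have "u \<in> lspan (basis_upto k)" using less that by blast
      then have "inner_T u q = 0 \<and> continuous_on simplex_T u"
      proof (induction rule: lspan.induct)
        case zero
        then show ?case by (simp add: inner_T_zero_left)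
      next
        case (add g h d)
        obtain b where "b \<in> (SIGMA l':{..k}. {1..r_dim CARD('d) l'})" and g: "g = Q b"
          using add.hyps unfolding basis_upto_def Q_def by blast
        then have b: "b \<in> A" "g = Q b" using \<open>k < l\<close> by (auto simp: A_def)
        have dg: "continuous_on simplex_T (\<lambda>x. d * g x)"
          unfolding b(2) by (intro continuous_intros Q b)
        have "inner_T (\<lambda>x. d * g x + h x) q = d * inner_T g q + inner_T h q"
          using dg add.IH cont by (simp only: inner_T_add_left inner_T_scale_left)
        then show ?case using add.IH ortho_basis[OF b(1)] dg b(2)
          by (auto intro!: continuous_on_add)
      qed
      then show ?thesis by simp
    qed
    then have "q \<in> V_space l"
      using q by (auto simp: V_space_def inner_T_commute)
    then obtain d where "q = (\<lambda>x. \<Sum>k\<in>{1..r_dim CARD('d) l}. d k * P l k x)"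
      using basis unfolding is_ONB_family_def by blast
    then have "q \<in> lspan (basis_upto l)"
      using base[of l] by (auto intro!: lspan_sum lspan_scale)
    moreover have "s \<in> lspan (basis_upto l)"
      unfolding s_def[abs_def]
      by (intro lspan_sum lspan_scale finA) (auto simp: A_def Q_def intro!: base)
    moreover have "p = (\<lambda>x. q x + s x)" by (simp add: q_def)
    ultimately show "p \<in> lspan (basis_upto l)" using lspan_add by metis
  qed
qed

definition basis_functions :: "(real ^ 'd \<Rightarrow> real) set" where
  "basis_functions = (\<lambda>(l, k). P l k) ` (SIGMA l:UNIV. {1..r_dim CARD('d) l})"

lemma poly_in_lspan_basis: "p \<in> polys_le l \<Longrightarrow> p \<in> lspan basis_functions"
  using polys_le_subset_lspan_basis
  by (rule lspan_mono[OF subsetD]) (auto simp: basis_upto_def basis_functions_def)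

end

section \<open>Integration on the product of simplices\<close>

definition cube_measure :: "nat \<Rightarrow> (nat \<Rightarrow> real ^ 'd::finite) measure" where
  "cube_measure m = (\<Pi>\<^sub>M j\<in>{1..m}. lborel)"

lemma product_sigma_finite_lborel: "product_sigma_finite (\<lambda>_ :: nat. lborel :: (real ^ 'd::finite) measure)"
  by unfold_locales

text \<open>
  A point of the cube is \<open>undefined\<close> outside \<open>{1..m}\<close>, so the cube is a product of compact sets over all
  natural numbers, the factors outside \<open>{1..m}\<close> being singletons. Compactness thus refers to the topology of
  the full function space, the one that \<open>continuous_on\<close> uses.
\<close>

lemma compact_cube: "compact (cube_T m :: (nat \<Rightarrow> real ^ 'd::finite) set)"
proof -
  let ?X = "\<lambda>j. if j \<in> {1..m} then simplex_T else {undefined :: real ^ 'd}"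
  have "compactin (product_topology (\<lambda>_. euclidean) UNIV) (\<Pi>\<^sub>E j\<in>UNIV. ?X j)"
    unfolding compactin_PiE using compact_simplex by auto
  moreover have "(\<Pi>\<^sub>E j\<in>UNIV. ?X j) = cube_T m"
  proof (rule set_eqI)
    fix x :: "nat \<Rightarrow> real ^ 'd"
    have "x \<in> (\<Pi>\<^sub>E j\<in>UNIV. ?X j) \<longleftrightarrow> (\<forall>j. x j \<in> ?X j)" by (simp add: PiE_iff)
    also have "\<dots> \<longleftrightarrow> x \<in> cube_T m"
      unfolding cube_T_def PiE_iff extensional_def by (auto split: if_split_asm)
    finally show "x \<in> (\<Pi>\<^sub>E j\<in>UNIV. ?X j) \<longleftrightarrow> x \<in> cube_T m" .
  qed
  ultimately show ?thesis by (simp add: euclidean_product_topology)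
qed

lemma simplex_sets [measurable]: "simplex_T \<in> sets (borel :: (real ^ 'd::finite) measure)"
  using closed_simplex by (rule borel_closed)

lemma cube_sets: "cube_T m \<in> sets (cube_measure m)"
  unfolding cube_T_def cube_measure_def by (rule sets_PiM_I_finite) auto

lemma emeasure_cube_finite: "emeasure (cube_measure m) (cube_T m :: (nat \<Rightarrow> real ^ 'd::finite) set) < \<infinity>"
proof -
  interpret product_sigma_finite "\<lambda>_ :: nat. lborel :: (real ^ 'd) measure"
    by (rule product_sigma_finite_lborel)
  have "emeasure (cube_measure m) (cube_T m :: (nat \<Rightarrow> real ^ 'd) set)
      = (\<Prod>j\<in>{1..m}. emeasure lborel (simplex_T :: (real ^ 'd) set))"
    unfolding cube_T_def cube_measure_def by (rule emeasure_PiM) auto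
  also have "\<dots> < \<infinity>"
    using emeasure_compact_finite[OF compact_simplex[where 'd='d]]
    by (auto simp: less_top[symmetric] power_eq_top_ennreal)
  finally show ?thesis .
qed

lemma space_cube_measure: "space (cube_measure m) = extensional {1..m}"
  by (simp add: cube_measure_def space_PiM PiE_UNIV_domain PiE_def)

text \<open>
  The bridge between the product measure over \<open>{1..m}\<close> and the topology of the full function space: continuous
  functions on the cube become measurable for the product measure.
\<close>

lemma cube_measurable_borel: "(\<lambda>x. x) \<in> measurable (cube_measure m) (borel :: (nat \<Rightarrow> real ^ 'd::finite) measure)"
proof (rule measurable_coordinatewise_then_product)
  fix j :: nat
  show "(\<lambda>x :: nat \<Rightarrow> real ^ 'd. x j) \<in> borel_measurable (cube_measure m)"
  proof (cases "j \<in> {1..m}")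
    case True
    then have "(\<lambda>x. x j) \<in> measurable (\<Pi>\<^sub>M j\<in>{1..m}. lborel :: (real ^ 'd) measure) lborel"
      by (rule measurable_component_singleton)
    then show ?thesis by (simp add: cube_measure_def)
  next
    case False
    then have "x j = undefined" if "x \<in> space (cube_measure m)" for x :: "nat \<Rightarrow> real ^ 'd"
      using that by (simp add: space_cube_measure extensional_def)
    then show ?thesis by (subst measurable_cong[where g = "\<lambda>_. undefined"]) auto
  qed
qed

lemma cube_integrable:
  fixes f :: "(nat \<Rightarrow> real ^ 'd::finite) \<Rightarrow> real"
  assumes f: "continuous_on (cube_T m) f"
  shows "set_integrable (cube_measure m) (cube_T m) f"
proof -
  obtain b where b: "\<And>x. x \<in> cube_T m \<Longrightarrow> norm (f x) \<le> b"
  proof -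
    have "bounded (f ` cube_T m)"
      by (rule compact_imp_bounded[OF compact_continuous_image[OF f compact_cube]])
    then show thesis using that unfolding bounded_iff by auto
  qed
  have "(\<lambda>x. indicator (cube_T m) x *\<^sub>R f x) \<in> borel_measurable borel"
    by (intro borel_measurable_continuous_on_indicator f borel_closed compact_imp_closed compact_cube)
  from measurable_compose[OF cube_measurable_borel this]
  have meas: "(\<lambda>x. indicator (cube_T m) x *\<^sub>R f x) \<in> borel_measurable (cube_measure m)" .
  have int: "integrable (cube_measure m) (\<lambda>x :: nat \<Rightarrow> real ^ 'd. indicator (cube_T m) x *\<^sub>R b)"
    by (intro integrable_scaleR_left integrable_real_indicator cube_sets emeasure_cube_finite)
  have "norm (indicator (cube_T m) x *\<^sub>R f x) \<le> norm (indicator (cube_T m) x *\<^sub>R b)" for x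
  proof (cases "x \<in> cube_T m")
    case True
    then have "norm (f x) \<le> \<bar>b\<bar>" using b[OF True] by linarith
    then show ?thesis using True by simp
  qed simp
  then show ?thesis
    unfolding set_integrable_def
    by (intro Bochner_Integration.integrable_bound[OF int meas] AE_I2)
qed

lemma emeasure_open_pos:
  assumes "open U" "U \<noteq> {}"
  shows "emeasure lborel (U :: (real ^ 'd::finite) set) > 0"
proof -
  have "U \<notin> null_sets lborel"
    using open_not_negligible[OF assms] null_sets_completionI negligible_iff_null_sets by blast
  then show ?thesis using assms by (auto simp: null_sets_def zero_less_iff_neq_zero)
qed

text \<open>
  If \<open>f\<close> did not vanish at \<open>x0\<close>, it would be nonzero on a neighbourhood of \<open>x0\<close> in the cube. This
  neighbourhood contains a box whose sides are nonempty open subsets of the simplex, and such a box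
  has positive measure.
\<close>

lemma continuous_zero_if_square_integral_zero:
  fixes f :: "(nat \<Rightarrow> real ^ 'd::finite) \<Rightarrow> real"
  assumes f: "continuous_on (cube_T m) f"
    and zero: "(LINT x:cube_T m|cube_measure m. f x * f x) = 0"
    and x0: "x0 \<in> cube_T m"
  shows "f x0 = 0"
proof (rule ccontr)
  interpret product_sigma_finite "\<lambda>_ :: nat. lborel :: (real ^ 'd) measure"
    by (rule product_sigma_finite_lborel)
  assume nz: "f x0 \<noteq> 0"
  obtain U where U: "open U" "U \<inter> cube_T m = f -` (- {0}) \<inter> cube_T m"
    using f[unfolded continuous_on_open_invariant, rule_format, of "- {0}"] by auto
  then have "x0 \<in> U" using nz x0 by blast
  have "openin (product_topology (\<lambda>_. euclidean) UNIV) U"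
    using U(1) by (simp add: euclidean_product_topology)
  from product_topology_open_contains_basis[OF this \<open>x0 \<in> U\<close>]
  obtain X where X: "x0 \<in> (\<Pi>\<^sub>E j\<in>UNIV. X j)" "\<And>j. open (X j)" "(\<Pi>\<^sub>E j\<in>UNIV. X j) \<subseteq> U"
    by auto
  define W where "W = (\<Pi>\<^sub>E j\<in>{1..m}. X j \<inter> interior simplex_T)"
  have "W \<subseteq> cube_T m"
    unfolding W_def cube_T_def by (rule PiE_mono) (use interior_subset in blast)
  moreover have "W \<subseteq> U"
  proof
    fix x assume x: "x \<in> W"
    have "x j \<in> X j" for j
    proof (cases "j \<in> {1..m}")
      case True
      then show ?thesis using x by (auto simp: W_def)
    next
      case False
      then have "x j = x0 j" using x x0 by (simp add: W_def cube_T_def PiE_arb[of _ _ _ j])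
      then show ?thesis using X(1) by auto
    qed
    then show "x \<in> U" using X(3) by auto
  qed
  ultimately have W: "f x \<noteq> 0 \<and> x \<in> cube_T m" if "x \<in> W" for x using U(2) that by blast
  have "AE x in cube_measure m. indicator (cube_T m) x *\<^sub>R (f x * f x) = 0"
    using zero cube_integrable[OF continuous_on_mult[OF f f]]
    unfolding set_lebesgue_integral_def set_integrable_def
    by (subst (asm) integral_nonneg_eq_0_iff_AE) auto
  then have "AE x in cube_measure m. \<not> x \<in> W"
  proof (rule eventually_mono)
    fix x assume "indicator (cube_T m) x *\<^sub>R (f x * f x) = 0"
    then show "\<not> x \<in> W" using W[of x] by auto
  qed
  then have "emeasure (cube_measure m) {x \<in> space (cube_measure m). x \<in> W} = 0"
    by (rule emeasure_eq_0_AE)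
  moreover have "{x \<in> space (cube_measure m). x \<in> W} = W"
    unfolding space_cube_measure W_def PiE_def by blast
  moreover have "emeasure (cube_measure m) W = (\<Prod>j\<in>{1..m}. emeasure lborel (X j \<inter> interior simplex_T))"
    unfolding W_def cube_measure_def using X(2) by (intro emeasure_PiM) auto
  ultimately obtain j where j: "j \<in> {1..m}" "emeasure lborel (X j \<inter> interior simplex_T) = 0"
    by auto
  have "x0 j \<in> closure (interior simplex_T)" "x0 j \<in> X j"
    using x0 j(1) X(1) simplex_subset_closure_interior by (auto simp: cube_T_def)
  then have "X j \<inter> interior simplex_T \<noteq> {}"
    using open_Int_closure_eq_empty[OF X(2)] by blast
  then show False
    using emeasure_open_pos[of "X j \<inter> interior simplex_T"] X(2) j(2) by auto
qed

lemma integral_m_prod: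
  fixes g :: "nat \<Rightarrow> real ^ 'd::finite \<Rightarrow> real"
  assumes g: "\<And>j. j \<in> {1..m} \<Longrightarrow> continuous_on simplex_T (g j)"
  shows "integral_m m (\<lambda>x. \<Prod>j=1..m. g j (x j)) = (\<Prod>j=1..m. inner_T (g j) (\<lambda>x. 1))"
proof -
  interpret product_sigma_finite "\<lambda>_ :: nat. lborel :: (real ^ 'd) measure"
    by (rule product_sigma_finite_lborel)
  have "(LINT x:cube_T m|(\<Pi>\<^sub>M j\<in>{1..m}. lborel). (\<Prod>j=1..m. g j (x j)))
     = (\<integral>x. (\<Prod>j\<in>{1..m}. indicator simplex_T (x j) *\<^sub>R g j (x j)) \<partial>(\<Pi>\<^sub>M j\<in>{1..m}. lborel))"
    unfolding set_lebesgue_integral_def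
  proof (rule Bochner_Integration.integral_cong)
    fix x :: "nat \<Rightarrow> real ^ 'd" assume "x \<in> space (\<Pi>\<^sub>M j\<in>{1..m}. lborel)"
    then have "x \<in> cube_T m \<longleftrightarrow> (\<forall>j\<in>{1..m}. x j \<in> simplex_T)"
      by (auto simp: space_PiM cube_T_def PiE_iff)
    moreover have "(\<Prod>j\<in>{1..m}. indicator simplex_T (x j)) = (if (\<forall>j\<in>{1..m}. x j \<in> simplex_T) then 1 else (0 :: real))"
      by (auto simp: indicator_def intro!: prod_zero)
    ultimately show "indicator (cube_T m) x *\<^sub>R (\<Prod>j=1..m. g j (x j))
        = (\<Prod>j\<in>{1..m}. indicator simplex_T (x j) *\<^sub>R g j (x j))"
      by (simp add: prod.distrib)
  qed simp
  also have "\<dots> = (\<Prod>j\<in>{1..m}. LINT y:simplex_T|lborel. g j y)"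
    unfolding set_lebesgue_integral_def
    by (rule product_integral_prod)
      (use simplex_integrable[OF g] in \<open>simp_all add: set_integrable_def\<close>)
  finally show ?thesis
    by (simp add: integral_m_def inner_T_def prod.distrib)
qed

lemma integral_m_eq: "integral_m m f = fact CARD('d) ^ m * (LINT x:cube_T m|cube_measure m. f x)"
  for f :: "(nat \<Rightarrow> real ^ 'd::finite) \<Rightarrow> real"
  by (simp add: integral_m_def cube_measure_def)

lemma positive_mean_cube:
  assumes one: "inner_T (\<lambda>x :: real ^ 'd::finite. 1) (\<lambda>x. 1) = 1"
  shows "positive_mean (cube_T m :: (nat \<Rightarrow> real ^ 'd) set) (integral_m m)"
proof (rule positive_mean.intro)
  show "compact (cube_T m :: (nat \<Rightarrow> real ^ 'd) set)" by (rule compact_cube)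
next
  show "integral_m m (\<lambda>x :: nat \<Rightarrow> real ^ 'd. 1) = 1"
    using integral_m_prod[of m "\<lambda>_ (x :: real ^ 'd). 1"] one by simp
next
  fix f :: "(nat \<Rightarrow> real ^ 'd) \<Rightarrow> real" and c :: real
  show "integral_m m (\<lambda>x. c * f x) = c * integral_m m f"
    unfolding integral_m_eq by (simp only: set_integral_mult_right mult.left_commute)
next
  fix f :: "(nat \<Rightarrow> real ^ 'd) \<Rightarrow> real" and x :: "nat \<Rightarrow> real ^ 'd"
  assume "continuous_on (cube_T m) f" "integral_m m (\<lambda>x. f x * f x) = 0" "x \<in> cube_T m"
  then show "f x = 0"
    by (intro continuous_zero_if_square_integral_zero[of m f x]) (simp_all add: integral_m_eq)
next
  fix f g :: "(nat \<Rightarrow> real ^ 'd) \<Rightarrow> real"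
  assume fg: "continuous_on (cube_T m) f" "continuous_on (cube_T m) g"
  show "integral_m m (\<lambda>x. f x + g x) = integral_m m f + integral_m m g"
    unfolding integral_m_eq set_integral_add(2)[OF cube_integrable[OF fg(1)] cube_integrable[OF fg(2)]]
    by (rule distrib_left)
next
  fix f g :: "(nat \<Rightarrow> real ^ 'd) \<Rightarrow> real"
  assume fg: "continuous_on (cube_T m) f" "continuous_on (cube_T m) g"
    and le: "\<And>x. x \<in> cube_T m \<Longrightarrow> f x \<le> g x"
  have "(LINT x:cube_T m|cube_measure m. f x) \<le> (LINT x:cube_T m|cube_measure m. g x)"
    by (rule set_integral_mono[OF cube_integrable[OF fg(1)] cube_integrable[OF fg(2)] le])
  then show "integral_m m f \<le> integral_m m g"
    unfolding integral_m_eq by (rule mult_left_mono) simp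
qed

section \<open>Tensor products of the basis functions\<close>

context simplex_basis
begin

definition tensor :: "nat \<Rightarrow> (nat \<Rightarrow> nat) \<times> (nat \<Rightarrow> nat) \<Rightarrow> (nat \<Rightarrow> real ^ 'd) \<Rightarrow> real" where
  "tensor m a x = (\<Prod>j=1..m. P (fst a j) (snd a j) (x j))"

definition indices :: "nat \<Rightarrow> ((nat \<Rightarrow> nat) \<times> (nat \<Rightarrow> nat)) set" where
  "indices m = (SIGMA l:(\<Pi>\<^sub>E j\<in>{1..m}. UNIV). \<Pi>\<^sub>E j\<in>{1..m}. {1..r_dim CARD('d) (l j)})"

definition zero_index :: "nat \<Rightarrow> (nat \<Rightarrow> nat) \<times> (nat \<Rightarrow> nat)" where
  "zero_index m = (\<lambda>j\<in>{1..m}. 0, \<lambda>j\<in>{1..m}. 1)"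

lemma zero_index_in: "zero_index m \<in> indices m"
  by (simp add: zero_index_def indices_def PiE_iff r_dim_def)

lemma tensor_zero_index: "tensor m (zero_index m) = (\<lambda>x. 1)"
  by (simp add: tensor_def[abs_def] zero_index_def first[simplified])

lemma index_in_dims: "a \<in> indices m \<Longrightarrow> j \<in> {1..m} \<Longrightarrow> snd a j \<in> {1..r_dim CARD('d) (fst a j)}"
  by (auto simp: indices_def PiE_iff)

lemma tensor_continuous:
  assumes a: "a \<in> indices m"
  shows "continuous_on S (tensor m a)"
  unfolding tensor_def[abs_def]
proof (rule continuous_on_prod)
  fix j assume j: "j \<in> {1..m}"
  have "continuous_on S (\<lambda>x :: nat \<Rightarrow> real ^ 'd. x j)"
    by (rule continuous_on_subset[OF continuous_on_product_coordinates]) simp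
  then show "continuous_on S (\<lambda>x. P (fst a j) (snd a j) (x j))"
    by (rule continuous_on_compose2[OF continuous_basis[OF index_in_dims[OF a j], of UNIV]]) simp
qed

lemma tensor_orthonormal:
  assumes a: "a \<in> indices m" and b: "b \<in> indices m"
  shows "integral_m m (\<lambda>x. tensor m a x * tensor m b x) = (if a = b then 1 else 0)"
proof -
  let ?g = "\<lambda>j y. P (fst a j) (snd a j) y * P (fst b j) (snd b j) y"
  have "integral_m m (\<lambda>x. tensor m a x * tensor m b x) = integral_m m (\<lambda>x. \<Prod>j=1..m. ?g j (x j))"
    by (simp add: tensor_def prod.distrib)
  also have "\<dots> = (\<Prod>j=1..m. inner_T (?g j) (\<lambda>x. 1))"
    by (intro integral_m_prod continuous_on_mult continuous_basis index_in_dims[OF a] index_in_dims[OF b])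
  also have "\<dots> = (\<Prod>j=1..m. if fst a j = fst b j \<and> snd a j = snd b j then 1 else 0)"
  proof (rule prod.cong)
    fix j assume j: "j \<in> {1..m}"
    have "inner_T (?g j) (\<lambda>x. 1) = inner_T (P (fst a j) (snd a j)) (P (fst b j) (snd b j))"
      by (simp add: inner_T_def)
    then show "inner_T (?g j) (\<lambda>x. 1) = (if fst a j = fst b j \<and> snd a j = snd b j then 1 else 0)"
      using inner_basis[OF index_in_dims[OF a j] index_in_dims[OF b j]] by simp
  qed simp
  also have "\<dots> = (if a = b then 1 else 0)"
  proof (cases "\<forall>j\<in>{1..m}. fst a j = fst b j \<and> snd a j = snd b j")
    case True
    have "fst a = fst b"
      by (rule PiE_ext[where k = "{1..m}" and s = "\<lambda>_. UNIV"]) (use a b True in \<open>auto simp: indices_def\<close>)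
    moreover have "snd a = snd b"
      by (rule PiE_ext[where k = "{1..m}" and s = "\<lambda>j. {1..r_dim CARD('d) (fst a j)}"])
        (use a b True \<open>fst a = fst b\<close> in \<open>auto simp: indices_def\<close>)
    ultimately show ?thesis using True by (simp add: prod_eq_iff)
  next
    case False
    then have "a \<noteq> b" by auto
    moreover have "(\<Prod>j=1..m. if fst a j = fst b j \<and> snd a j = snd b j then 1 else (0 :: real)) = 0"
      using False by (intro prod_zero) auto
    ultimately show ?thesis by simp
  qed
  finally show ?thesis .
qed

text \<open>
  Multilinearity, one coordinate at a time: the factors with index in \<open>A\<close> are expanded
  in the basis, the others already are basis functions.
\<close>

lemma product_of_spanned_in_lspan_tensors:
  assumes "finite A" "A \<subseteq> {1..m}" "\<And>j. j \<in> A \<Longrightarrow> h j \<in> lspan basis_functions"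
    "\<And>j. j \<in> {1..m} - A \<Longrightarrow> h j \<in> basis_functions"
  shows "(\<lambda>x. \<Prod>j=1..m. h j (x j)) \<in> lspan (tensor m ` indices m)"
  using assms
proof (induction A arbitrary: h rule: finite_induct)
  case empty
  have "\<exists>a. snd a \<in> {1..r_dim CARD('d) (fst a)} \<and> h j = P (fst a) (snd a)" if "j \<in> {1..m}" for j
    using empty(3)[of j] that unfolding basis_functions_def by fastforce
  then obtain a where a: "\<And>j. j \<in> {1..m} \<Longrightarrow> snd (a j) \<in> {1..r_dim CARD('d) (fst (a j))}
      \<and> h j = P (fst (a j)) (snd (a j))"
    by metis
  let ?b = "(\<lambda>j\<in>{1..m}. fst (a j), \<lambda>j\<in>{1..m}. snd (a j))"
  have "?b \<in> indices m" using a by (auto simp: indices_def)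
  moreover have "(\<lambda>x. \<Prod>j=1..m. h j (x j)) = tensor m ?b"
    unfolding tensor_def[abs_def] using a by (intro ext prod.cong) auto
  ultimately show ?case by (auto intro: lspan_base)
next
  case (insert i A)
  have split: "(\<Prod>j=1..m. (h(i := u)) j (x j)) = u (x i) * (\<Prod>j\<in>{1..m} - {i}. h j (x j))" for u x
    using insert.prems(1) by (subst prod.remove[of "{1..m}" i]) auto
  have "(\<lambda>x. \<Prod>j=1..m. (h(i := u)) j (x j)) \<in> lspan (tensor m ` indices m)"
    if "u \<in> lspan basis_functions" for u
    using that
  proof (induction rule: lspan.induct)
    case zero
    show ?case unfolding split by (simp add: lspan.zero)
  next
    case (add g u c)
    have "(\<lambda>x. \<Prod>j=1..m. (h(i := g)) j (x j)) \<in> lspan (tensor m ` indices m)"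
      by (rule insert.IH) (use insert add.hyps in auto)
    from lspan_add[OF lspan_scale[OF this, of c] add.IH]
    show ?case by (simp only: split distrib_right mult.assoc)
  qed
  from this[of "h i"] show ?case using insert.prems(2)[of i] by simp
qed

lemma product_of_polys_in_lspan_tensors:
  assumes "\<And>j. j \<in> {1..m} \<Longrightarrow> h j \<in> polys_le (n j)"
  shows "(\<lambda>x. \<Prod>j=1..m. h j (x j)) \<in> lspan (tensor m ` indices m)"
  by (rule product_of_spanned_in_lspan_tensors[of "{1..m}"]) (use assms poly_in_lspan_basis in auto)

text \<open>
  The Stone-Weierstrass theorem. The span of the tensors is an algebra because a product of two tensors
  is a product of polynomials in the separate coordinates, and it separates points because it contains the coordinate
  functions.
\<close>

lemma tensors_dense:
  assumes f: "continuous_on (cube_T m) f" and e: "e > 0"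
  shows "\<exists>p\<in>lspan (tensor m ` indices m). \<forall>x\<in>cube_T m. \<bar>f x - p x\<bar> < e"
proof -
  let ?R = "lspan (tensor m ` indices m)"
  have "function_ring_on ?R (cube_T m)"
  proof
    show "compact (cube_T m :: (nat \<Rightarrow> real ^ 'd) set)" by (rule compact_cube)
    show "continuous_on (cube_T m) p" if "p \<in> ?R" for p
      using that by (rule continuous_on_lspan) (auto intro: tensor_continuous)
    show "(\<lambda>x. p x + q x) \<in> ?R" if "p \<in> ?R" "q \<in> ?R" for p q
      using that by (rule lspan_add)
    show "(\<lambda>x. p x * q x) \<in> ?R" if "p \<in> ?R" "q \<in> ?R" for p q
      using that
    proof (rule lspan_mult, clarify)
      fix l k l' k' assume ab: "(l, k) \<in> indices m" "(l', k') \<in> indices m"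
      have "(\<lambda>x. \<Prod>j=1..m. P (l j) (k j) (x j) * P (l' j) (k' j) (x j)) \<in> ?R"
        by (rule product_of_polys_in_lspan_tensors[where n = "\<lambda>j. l j + l' j"])
          (use index_in_dims[OF ab(1)] index_in_dims[OF ab(2)] in \<open>auto intro!: polys_le_mult in_polys_le\<close>)
      then show "(\<lambda>x. tensor m (l, k) x * tensor m (l', k') x) \<in> ?R"
        by (simp add: tensor_def prod.distrib)
    qed
    show "(\<lambda>_. c) \<in> ?R" for c
      using lspan_scale[OF lspan_base[OF imageI[OF zero_index_in]], of c "tensor m" m]
      by (simp add: tensor_zero_index)
    fix x y :: "nat \<Rightarrow> real ^ 'd"
    assume xy: "x \<in> cube_T m" "y \<in> cube_T m" "x \<noteq> y"
    then obtain j where j: "j \<in> {1..m}" "x j \<noteq> y j"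
      unfolding cube_T_def using PiE_ext by blast
    then obtain i where i: "x j $ i \<noteq> y j $ i" by (auto simp: vec_eq_iff)
    define h :: "nat \<Rightarrow> real ^ 'd \<Rightarrow> real" where "h j' = (if j' = j then (\<lambda>z. z $ i) else (\<lambda>z. 1))" for j'
    have "(\<lambda>x. \<Prod>j=1..m. h j (x j)) \<in> ?R"
      by (rule product_of_polys_in_lspan_tensors[where n = "\<lambda>j'. if j' = j then 1 else 0"])
        (auto simp: h_def intro: coordinate_poly[simplified] const_poly)
    moreover have "(\<Prod>j=1..m. h j (z j)) = z j $ i" for z
      using j(1) by (subst prod.remove[of _ j]) (auto simp: h_def)
    ultimately show "\<exists>f\<in>?R. f x \<noteq> f y" using i by (intro bexI[of _ "\<lambda>x. \<Prod>j=1..m. h j (x j)"]) auto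
  qed
  then show ?thesis using f e by (rule function_ring_on.Stone_Weierstrass_basic)
qed

end

section \<open>The reproducing kernel on the diagonal\<close>

text \<open>
  The terms are at most \<open>l powr (2 * d - 2 * r)\<close> with \<open>l = Suc i\<close>, and the exponent is below \<open>-2\<close>.
\<close>

lemma summable_c_terms:
  assumes r: "r > real d + 1"
  shows "summable (\<lambda>i. real (Suc i) ^ (2 * d) / real (Suc i * (Suc i + d)) powr r)"
proof (rule summable_comparison_test')
  show "summable (\<lambda>i. real (Suc i) powr (2 * real d - 2 * r))"
    using r by (subst summable_Suc_iff) (simp add: summable_real_powr_iff)
  fix i :: nat
  define l where "l = Suc i"
  have l: "real l > 0" by (simp add: l_def)
  have "real l powr (2 * r) = (real l * real l) powr r"
    by (simp add: powr_mult powr_add[symmetric])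
  also have "\<dots> \<le> real (l * (l + d)) powr r"
    using r by (intro powr_mono2) (auto simp: mult_left_mono)
  finally have "real l ^ (2 * d) / real (l * (l + d)) powr r \<le> real l ^ (2 * d) / real l powr (2 * r)"
    using l by (intro divide_left_mono) auto
  also have "\<dots> = real l powr (2 * real d - 2 * r)"
    using l by (simp add: powr_diff powr_realpow[symmetric])
  finally show "norm (real (Suc i) ^ (2 * d) / real (Suc i * (Suc i + d)) powr r)
      \<le> real (Suc i) powr (2 * real d - 2 * r)"
    by (simp add: l_def)
qed

context simplex_basis
begin

lemma one_variable_diagonal_bound:
  assumes M: "\<And>l. l \<ge> 1 \<Longrightarrow> P_kernel P l y y \<le> M * real l ^ (2 * CARD('d))"
    and r: "r > real CARD('d) + 1" and g: "g > 0"
  shows "(\<Sum>l\<le>L. \<Sum>k\<in>{1..r_dim CARD('d) l}. (P l k y)\<^sup>2 / B_coeff CARD('d) r g l)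
      \<le> 1 + g * c_const CARD('d) r M"
proof -
  let ?t = "\<lambda>i. real (Suc i) ^ (2 * CARD('d)) / real (Suc i * (Suc i + CARD('d))) powr r"
  have "M \<ge> 0"
  proof -
    have "0 \<le> P_kernel P 1 y y" unfolding P_kernel_def by (intro sum_nonneg) simp
    then show ?thesis using M[of 1] by simp
  qed
  have kernel: "(\<Sum>k\<in>{1..r_dim CARD('d) l}. (P l k y)\<^sup>2 / B_coeff CARD('d) r g l)
      = P_kernel P l y y / B_coeff CARD('d) r g l" for l
    by (simp add: P_kernel_def sum_divide_distrib power2_eq_square)
  have zero: "P_kernel P 0 y y / B_coeff CARD('d) r g 0 = 1"
    unfolding P_kernel_def dims_zero by (simp add: B_coeff_def first[simplified])
  have degree_bound: "P_kernel P (Suc i) y y / B_coeff CARD('d) r g (Suc i) \<le> g * M * ?t i" for i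
  proof -
    have "P_kernel P (Suc i) y y / B_coeff CARD('d) r g (Suc i)
        = g / real (Suc i * (Suc i + CARD('d))) powr r * P_kernel P (Suc i) y y"
      by (simp add: B_coeff_def)
    also have "\<dots> \<le> g / real (Suc i * (Suc i + CARD('d))) powr r * (M * real (Suc i) ^ (2 * CARD('d)))"
      using g by (intro mult_left_mono M) auto
    finally show ?thesis by (simp add: mult_ac)
  qed
  have "(\<Sum>l\<le>L. \<Sum>k\<in>{1..r_dim CARD('d) l}. (P l k y)\<^sup>2 / B_coeff CARD('d) r g l)
      = 1 + (\<Sum>i<L. P_kernel P (Suc i) y y / B_coeff CARD('d) r g (Suc i))"
    unfolding kernel lessThan_Suc_atMost[symmetric] sum.lessThan_Suc_shift zero ..
  also have "\<dots> \<le> 1 + (\<Sum>i<L. g * M * ?t i)"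
    by (intro add_left_mono sum_mono degree_bound)
  also have "\<dots> = 1 + g * M * (\<Sum>i<L. ?t i)"
    by (simp only: sum_distrib_left)
  also have "\<dots> \<le> 1 + g * M * (\<Sum>i. ?t i)"
    using g \<open>M \<ge> 0\<close>
    by (intro add_left_mono mult_left_mono sum_le_suminf summable_c_terms r) auto
  also have "\<dots> = 1 + g * c_const CARD('d) r M"
    by (simp only: c_const_def Let_def mult.assoc)
  finally show ?thesis .
qed

definition weight :: "real \<Rightarrow> (nat \<Rightarrow> nat \<Rightarrow> real) \<Rightarrow> nat \<Rightarrow> (nat \<Rightarrow> nat) \<times> (nat \<Rightarrow> nat) \<Rightarrow> real" where
  "weight r \<gamma> m a = (\<Prod>j=1..m. B_coeff CARD('d) r (\<gamma> m j) (fst a j))"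

lemma B_coeff_pos: "g > 0 \<Longrightarrow> B_coeff CARD('d) r g l > 0"
  by (simp add: B_coeff_def)

lemma weight_positive:
  "(\<And>j. j \<in> {1..m} \<Longrightarrow> \<gamma> m j > 0) \<Longrightarrow> weight r \<gamma> m a > 0"
  unfolding weight_def by (intro prod_pos ballI B_coeff_pos)

text \<open>
  With the zero index included, the finite sum is dominated by the sum over all multi-indices with
  degrees at most some \<open>L\<close>. The latter is a product of sums in one variable, to which
  \<open>one_variable_diagonal_bound\<close> applies. The zero index itself contributes the \<open>1\<close> that is subtracted.
\<close>

lemma tensor_diagonal_bound:
  assumes M: "\<And>l y. l \<ge> 1 \<Longrightarrow> y \<in> simplex_T \<Longrightarrow> P_kernel P l y y \<le> M * real l ^ (2 * CARD('d))"
    and r: "r > real CARD('d) + 1" and \<gamma>: "\<And>j. j \<in> {1..m} \<Longrightarrow> \<gamma> m j > 0"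
    and x: "x \<in> cube_T m" and F: "finite F" "F \<subseteq> indices m - {zero_index m}"
  shows "(\<Sum>a\<in>F. (tensor m a x)\<^sup>2 / weight r \<gamma> m a)
    \<le> (\<Prod>j=1..m. 1 + \<gamma> m j * c_const CARD('d) r M) - 1"
proof -
  let ?s = "\<lambda>a. (tensor m a x)\<^sup>2 / weight r \<gamma> m a"
  let ?u = "\<lambda>j l k. (P l k (x j))\<^sup>2 / B_coeff CARD('d) r (\<gamma> m j) l"
  let ?K = "\<lambda>l. \<Pi>\<^sub>E j\<in>{1..m}. {1..r_dim CARD('d) (l j)}"
  let ?F = "insert (zero_index m) F"
  define L where "L = Max (insert 0 ((\<lambda>(a, j). fst a j) ` (?F \<times> {1..m})))"
  define G where "G = (SIGMA l:(\<Pi>\<^sub>E j\<in>{1..m}. {..L}). ?K l)"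
  have "finite (\<Pi>\<^sub>E j\<in>{1..m}. {..L})" "\<And>l. finite (?K l)"
    by (intro finite_PiE; simp)+
  then have finG: "finite G" unfolding G_def by (intro finite_SigmaI) auto
  have le_L: "fst a j \<le> L" if "a \<in> ?F" "j \<in> {1..m}" for a j
    unfolding L_def using that F(1) by (intro Max_ge) auto
  have sub: "?F \<subseteq> G"
  proof
    fix a assume a: "a \<in> ?F"
    then have "a \<in> indices m" using F(2) zero_index_in by blast
    then show "a \<in> G" using le_L[OF a] by (auto simp: indices_def G_def PiE_iff)
  qed
  have zero_term: "?s (zero_index m) = 1"
    unfolding tensor_zero_index by (simp add: weight_def zero_index_def B_coeff_def)
  have "zero_index m \<notin> F" using F(2) by blast
  then have "1 + (\<Sum>a\<in>F. ?s a) = (\<Sum>a\<in>?F. ?s a)"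
    using sum.insert[OF F(1), of "zero_index m" ?s] zero_term by linarith
  also have "\<dots> \<le> (\<Sum>a\<in>G. ?s a)"
    using sub finG weight_positive[of m \<gamma> r] \<gamma>
    by (intro sum_mono2) (auto intro!: divide_nonneg_nonneg simp: less_imp_le)
  also have "\<dots> = (\<Sum>l\<in>(\<Pi>\<^sub>E j\<in>{1..m}. {..L}). \<Sum>k\<in>?K l. ?s (l, k))"
    unfolding G_def using \<open>finite (\<Pi>\<^sub>E j\<in>{1..m}. {..L})\<close> \<open>\<And>l. finite (?K l)\<close>
    by (subst sum.Sigma) auto
  also have "\<dots> = (\<Sum>l\<in>(\<Pi>\<^sub>E j\<in>{1..m}. {..L}). \<Sum>k\<in>?K l. \<Prod>j\<in>{1..m}. ?u j (l j) (k j))"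
    by (simp add: tensor_def weight_def prod_power_distrib prod_dividef)
  also have "\<dots> = (\<Sum>l\<in>(\<Pi>\<^sub>E j\<in>{1..m}. {..L}). \<Prod>j\<in>{1..m}. \<Sum>k\<in>{1..r_dim CARD('d) (l j)}. ?u j (l j) k)"
    by (intro sum.cong refl prod_sum_PiE[symmetric]) auto
  also have "\<dots> = (\<Prod>j\<in>{1..m}. \<Sum>l\<le>L. \<Sum>k\<in>{1..r_dim CARD('d) l}. ?u j l k)"
    by (rule prod_sum_PiE[symmetric]) auto
  also have "\<dots> \<le> (\<Prod>j\<in>{1..m}. 1 + \<gamma> m j * c_const CARD('d) r M)"
  proof (rule prod_mono, safe)
    fix j assume j: "j \<in> {1..m}"
    have xj: "x j \<in> simplex_T" using x j by (auto simp: cube_T_def)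
    show "0 \<le> (\<Sum>l\<le>L. \<Sum>k\<in>{1..r_dim CARD('d) l}. ?u j l k)"
      using B_coeff_pos[OF \<gamma>[OF j]] by (intro sum_nonneg divide_nonneg_pos) auto
    show "(\<Sum>l\<le>L. \<Sum>k\<in>{1..r_dim CARD('d) l}. ?u j l k) \<le> 1 + \<gamma> m j * c_const CARD('d) r M"
      by (rule one_variable_diagonal_bound[OF M r \<gamma>[OF j]]) (use xj in auto)
  qed
  finally show ?thesis by simp
qed

lemma tensor_system:
  assumes M: "\<And>l y. l \<ge> 1 \<Longrightarrow> y \<in> simplex_T \<Longrightarrow> P_kernel P l y y \<le> M * real l ^ (2 * CARD('d))"
    and r: "r > real CARD('d) + 1" and \<gamma>: "\<And>j. j \<in> {1..m} \<Longrightarrow> \<gamma> m j > 0"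
  shows "weighted_system (cube_T m) (integral_m m) (indices m - {zero_index m}) (tensor m)
    (weight r \<gamma> m) ((\<Prod>j=1..m. 1 + \<gamma> m j * c_const CARD('d) r M) - 1)"
proof (rule weighted_system.intro)
  have "inner_T (\<lambda>x :: real ^ 'd. 1) (\<lambda>x. 1) = 1"
    using inner_basis[of 1 0 1 0] unfolding dims_zero first by simp
  then show "positive_mean (cube_T m :: (nat \<Rightarrow> real ^ 'd) set) (integral_m m)"
    by (rule positive_mean_cube)
  show "weighted_system_axioms (cube_T m) (integral_m m) (indices m - {zero_index m}) (tensor m)
    (weight r \<gamma> m) ((\<Prod>j=1..m. 1 + \<gamma> m j * c_const CARD('d) r M) - 1)"
  proof
    fix a b assume a: "a \<in> indices m - {zero_index m}"
    show "continuous_on (cube_T m) (tensor m a)" using a by (intro tensor_continuous) auto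
    show "integral_m m (tensor m a) = 0"
      using a tensor_orthonormal[of a m "zero_index m"] zero_index_in
      by (simp add: tensor_zero_index)
    show "weight r \<gamma> m a > 0" using \<gamma> by (rule weight_positive)
    assume b: "b \<in> indices m - {zero_index m}"
    show "integral_m m (\<lambda>x. tensor m a x * tensor m b x) = (if a = b then 1 else 0)"
      using a b by (intro tensor_orthonormal) auto
  next
    fix x :: "nat \<Rightarrow> real ^ 'd" and F
    assume xF: "x \<in> cube_T m" "finite F" "F \<subseteq> indices m - {zero_index m}"
    show "(\<Sum>a\<in>F. (tensor m a x)\<^sup>2 / weight r \<gamma> m a)
        \<le> (\<Prod>j=1..m. 1 + \<gamma> m j * c_const CARD('d) r M) - 1"
      using M r \<gamma> xF by (intro tensor_diagonal_bound[where \<gamma> = \<gamma> and m = m]) auto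
  next
    fix f :: "(nat \<Rightarrow> real ^ 'd) \<Rightarrow> real" and e :: real
    assume "continuous_on (cube_T m) f" "e > 0"
    moreover have "insert (\<lambda>x. 1) (tensor m ` (indices m - {zero_index m})) = tensor m ` indices m"
      using zero_index_in tensor_zero_index by (metis image_insert insert_Diff)
    ultimately show "\<exists>p\<in>lspan (insert (\<lambda>x. 1) (tensor m ` (indices m - {zero_index m}))).
        \<forall>x\<in>cube_T m. \<bar>f x - p x\<bar> < e"
      using tensors_dense by simp
  qed
qed

section \<open>The worst-case error\<close>

lemma finite_sum_le_norm:
  assumes f: "finite_norm_m P r \<gamma> m f" "norm_m P r \<gamma> m f \<le> 1"
    and \<gamma>: "\<And>j. j \<in> {1..m} \<Longrightarrow> \<gamma> m j > 0"
    and F: "finite F" "F \<subseteq> indices m"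
  shows "(\<Sum>a\<in>F. weight r \<gamma> m a * (integral_m m (\<lambda>x. f x * tensor m a x))\<^sup>2) \<le> 1"
proof -
  let ?w = "\<lambda>a. weight r \<gamma> m a * (integral_m m (\<lambda>x. f x * tensor m a x))\<^sup>2"
  let ?K = "\<lambda>l. \<Pi>\<^sub>E j\<in>{1..m}. {1..r_dim CARD('d) (l j)}"
  have finK: "finite (?K l)" for l by (intro finite_PiE) auto
  have nonneg: "?w a \<ge> 0" for a using weight_positive[of m \<gamma> r a] \<gamma> by simp
  have inner: "inner_m_term P r \<gamma> m f f l = (\<Sum>k\<in>?K l. ?w (l, k))" for l
    by (simp add: inner_m_term_def weight_def coeff_m_def tensor_def power2_eq_square mult.assoc)
  have "(\<Sum>a\<in>F. ?w a) \<le> (\<Sum>a\<in>(SIGMA l:fst ` F. ?K l). ?w a)"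
  proof (rule sum_mono2)
    show "F \<subseteq> (SIGMA l:fst ` F. ?K l)"
    proof
      fix a assume "a \<in> F"
      moreover obtain l k where "a = (l, k)" by (cases a)
      ultimately show "a \<in> (SIGMA l:fst ` F. ?K l)"
        using F(2) unfolding indices_def by (auto simp del: PiE_iff intro: rev_image_eqI)
    qed
  qed (use F(1) nonneg finK in auto)
  also have "\<dots> = (\<Sum>l\<in>fst ` F. inner_m_term P r \<gamma> m f f l)"
    unfolding inner using F finK by (subst sum.Sigma) auto
  also have "\<dots> \<le> inner_m P r \<gamma> m f f"
    unfolding inner_m_def
  proof (rule finite_sum_le_infsum)
    show "inner_m_term P r \<gamma> m f f summable_on ({1..m} \<rightarrow>\<^sub>E UNIV)"
      using f(1) by (simp add: finite_norm_m_def)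
    show "fst ` F \<subseteq> {1..m} \<rightarrow>\<^sub>E UNIV"
    proof (rule image_subsetI)
      fix a assume "a \<in> F"
      then have "a \<in> indices m" using F(2) by blast
      then show "fst a \<in> {1..m} \<rightarrow>\<^sub>E UNIV" by (cases a) (simp add: indices_def)
    qed
    show "0 \<le> inner_m_term P r \<gamma> m f f l" for l
      unfolding inner by (intro sum_nonneg nonneg)
  qed (use F in simp)
  also have "\<dots> \<le> 1" using f(2) by (simp add: norm_m_def)
  finally show ?thesis .
qed

text \<open>
  The set over which the worst-case error takes its supremum is therefore nonempty. Otherwise the
  supremum would be \<open>-\<infinity>\<close>, and its square \<open>\<infinity>\<close>.
\<close>

lemma zero_in_H_space:
  "(\<lambda>x. 0) \<in> H_space P r \<gamma> m" "norm_m P r \<gamma> m (\<lambda>x. 0) = 0"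
proof -
  have [simp]: "inner_m_term P r \<gamma> m (\<lambda>x. 0) (\<lambda>x. 0) = (\<lambda>l. 0)"
    by (simp add: inner_m_term_def[abs_def] coeff_m_def integral_m_def)
  have fin: "finite_norm_m P r \<gamma> m (\<lambda>x. 0)" by (simp add: finite_norm_m_def)
  show norm: "norm_m P r \<gamma> m (\<lambda>x. 0) = 0" by (simp add: norm_m_def inner_m_def)
  have "(\<lambda>x. 0) \<in> alg_tensor P r \<gamma> m"
    unfolding alg_tensor_def by (rule CollectI, rule exI[of _ 0]) simp
  then show "(\<lambda>x. 0) \<in> H_space P r \<gamma> m"
    unfolding H_space_def using fin norm by (auto intro!: bexI[of _ "\<lambda>x. 0"])
qed

end

theorem lemma8:
  fixes P :: "nat \<Rightarrow> nat \<Rightarrow> real ^ 'd::finite \<Rightarrow> real"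
    and \<gamma> :: "nat \<Rightarrow> nat \<Rightarrow> real"
    and M r :: real and m n :: nat
  assumes "is_ONB_family P"
    and "P 0 1 = (\<lambda>x. 1)"
    and "\<forall>l\<ge>1. \<forall>x\<in>simplex_T. \<forall>y\<in>simplex_T. P_kernel P l x y \<le> M * real l ^ (2 * CARD('d))"
    and "\<forall>i\<ge>1. \<forall>j\<in>{1..i}. \<gamma> i j > 0"
    and "bdd_above {\<gamma> i j | i j. 1 \<le> i \<and> 1 \<le> j \<and> j \<le> i}"
    and "r > real CARD('d) + 1"
    and "m \<ge> 1" and "n \<ge> 1"
  shows "\<exists>t :: nat \<Rightarrow> nat \<Rightarrow> real ^ 'd. (\<forall>i\<in>{1..n}. t i \<in> cube_T m) \<and>
     (wce P r \<gamma> n m t)\<^sup>2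
       \<le> ereal (1 / real n * ((\<Prod>j=1..m. 1 + \<gamma> m j * c_const CARD('d) r M) - 1))"
proof -
  interpret simplex_basis P using assms(1,2) by unfold_locales
  define C where "C = (\<Prod>j=1..m. 1 + \<gamma> m j * c_const CARD('d) r M) - 1"
  have \<gamma>: "\<And>j. j \<in> {1..m} \<Longrightarrow> \<gamma> m j > 0" using assms(4,7) by blast
  interpret W: weighted_system "cube_T m" "integral_m m" "indices m - {zero_index m}" "tensor m"
    "weight r \<gamma> m" C
    unfolding C_def
    by (rule tensor_system[where \<gamma> = \<gamma> and m = m and r = r]) (use assms(3,6) \<gamma> in auto)
  obtain t where t: "\<And>i. i \<in> {1..n} \<Longrightarrow> t i \<in> cube_T m"
    and err: "\<And>f. continuous_on (cube_T m) f \<Longrightarrow>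
      (\<And>F. finite F \<Longrightarrow> F \<subseteq> indices m - {zero_index m} \<Longrightarrow>
        (\<Sum>a\<in>F. weight r \<gamma> m a * (integral_m m (\<lambda>x. f x * tensor m a x))\<^sup>2) \<le> 1) \<Longrightarrow>
      \<bar>(\<Sum>i=1..n. f (t i)) - real n * integral_m m f\<bar> \<le> sqrt (real n * C)"
    using W.exists_nodes_small_error[of n] by blast
  have n: "real n > 0" using assms(8) by simp
  have bound: "\<bar>integral_m m f - Q_rule n t f\<bar> \<le> sqrt (C / real n)"
    if f: "f \<in> H_space P r \<gamma> m" "norm_m P r \<gamma> m f \<le> 1" for f
  proof -
    have "\<bar>(\<Sum>i=1..n. f (t i)) - real n * integral_m m f\<bar> \<le> sqrt (real n * C)"
      using f unfolding H_space_def
      by (intro err finite_sum_le_norm \<gamma>) auto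
    moreover have "(\<Sum>i=1..n. f (t i)) - real n * integral_m m f
        = - (real n * (integral_m m f - Q_rule n t f))"
      using n by (simp add: Q_rule_def right_diff_distrib)
    ultimately have "real n * \<bar>integral_m m f - Q_rule n t f\<bar> \<le> sqrt (real n * C)"
      by (simp add: abs_mult)
    also have "sqrt (real n * C) = sqrt ((real n)\<^sup>2 * (C / real n))"
      using n by (simp add: power2_eq_square)
    also have "\<dots> = real n * sqrt (C / real n)"
      by (simp only: real_sqrt_mult real_sqrt_abs abs_of_nat)
    finally show ?thesis using n by simp
  qed
  have upper: "wce P r \<gamma> n m t \<le> ereal (sqrt (C / real n))"
    unfolding wce_def by (rule SUP_least) (use bound in auto)
  have "ereal \<bar>integral_m m (\<lambda>x :: nat \<Rightarrow> real ^ 'd. 0) - Q_rule n t (\<lambda>x. 0)\<bar>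
      \<le> wce P r \<gamma> n m t"
    unfolding wce_def by (rule SUP_upper2[of "\<lambda>x. 0"]) (simp_all add: zero_in_H_space)
  then have "0 \<le> wce P r \<gamma> n m t" by (rule order.trans[rotated]) simp
  then obtain w where w: "wce P r \<gamma> n m t = ereal w" "0 \<le> w" "w \<le> sqrt (C / real n)"
    using upper by (cases "wce P r \<gamma> n m t") auto
  have "w\<^sup>2 \<le> (sqrt (C / real n))\<^sup>2" using w by (intro power_mono)
  also have "\<dots> = C / real n" using W.bound_nonneg by simp
  finally have "(wce P r \<gamma> n m t)\<^sup>2 \<le> ereal (1 / real n * C)" by (simp add: w(1))
  then show ?thesis using t unfolding C_def by blast
qed

end
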